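(* The curvature identity $$\frac{1}{4}\left(|R|^2-4|\rho|^2+\tau^2\right)g-\check{R}+2\check{\rho}+L\rho-\tau\rho=0$$ is universal as a symmetric $2$-form valued quadratic curvature identity for $4$-dimensional Riemannian manifolds. That is, it is, up to a constant multiple, the only identity of its type holding on all $4$-dimensional Riemannian manifolds, in the following sense. Let $c_1,\dots,c_{10}$ be real constants. Then the identity $$\begin{aligned}&c_1|R|^2g+c_2|\rho|^2g+c_3\tau^2g+c_4\check{R}+c_5\check{\rho}+c_6L\rho+c_7\tau\rho\\&\quad+c_8(\triangle\tau)g+c_9\,\mathrm{Hess}\,\tau+c_{10}\tilde\triangle\rho=0\end{aligned}$$ holds at every point of every $4$-dimensional Riemannian manifold $(M,g)$ if and only if there is a real constant $\lambda$ such that $$c_1=\tfrac{\lambda}{4},\quad c_2=-\lambda,\quad c_3=\tfrac{\lambda}{4},\quad c_4=-\lambda,\quad c_5=2\lambda,\quad c_6=\lambda,\quad c_7=-\lambda,\quad c_8=c_9=c_{10}=0.$$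
   Context: Riemannian manifolds $(M,g)$ are smooth, with no compactness or orientability assumption. $\nabla$ is the Levi-Civita connection, and indices are raised and lowered with $g$. $R$ is the Riemann curvature tensor, with components $R_{ijkl}$ and the sign convention that $R_{abba}$ is the sectional curvature of the plane spanned by orthonormal vectors $e_a,e_b$ (so $R_{abab}$ is minus the sectional curvature). $\rho$ is the Ricci tensor and $\tau$ the scalar curvature, with the convention that both are positive on round spheres: $\rho(e_i,e_i)$ is the sum of the sectional curvatures of the planes spanned by $e_i$ and $e_a$, $a\neq i$, for an orthonormal basis $\{e_a\}$, and $\tau$ is the trace of $\rho$. Norms are the full tensor norms: $|R|^2=\sum R_{abcd}R^{abcd}$ and $|\rho|^2=\sum\rho_{ab}\rho^{ab}$. The symmetric $2$-tensors $\check R$, $\check\rho$, $L\rho$ are defined by $$\check{R}_{ij}=\sum_{a,b,c}R_{abci}{R^{abc}}_{j},\qquad \check{\rho}_{ij}=\sum_a\rho_{ai}\rho^{a}{}_{j},\qquad (L\rho)_{ij}=2\sum_{a,b}R_{iabj}\rho^{ab}.$$ $\mathrm{Hess}\,\tau=\nabla\nabla\tau$ is the Hessian of $\tau$. $\triangle\tau$ is the Laplacian of $\tau$, i.e. the trace of $\mathrm{Hess}\,\tau$ with respect to $g$. $\tilde\triangle\rho$ is the rough Laplacian of the Ricci tensor, $(\tilde\triangle\rho)_{ij}=\sum_a\nabla^a\nabla_a\rho_{ij}$. The ten tensors $|R|^2g$, $|\rho|^2g$, $\tau^2g$, $\check R$, $\check\rho$, $L\rho$, $\tau\rho$, $(\triangle\tau)g$,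 $\mathrm{Hess}\,\tau$, $\tilde\triangle\rho$ span the space of symmetric $2$-form valued invariants of Riemannian metrics that are homogeneous of degree $4$ in the derivatives of the metric. The identities under consideration are the vanishing of constant-coefficient linear combinations of them. *)

theory Defs
  imports "HOL-Analysis.Analysis"
begin

section \<open>Smooth functions on open subsets of \<open>\<real>\<^sup>n\<close>\<close>

definition pd :: "'n \<Rightarrow> (real^'n \<Rightarrow> real) \<Rightarrow> real^'n \<Rightarrow> real" where
  "pd i f x = deriv (\<lambda>t. f (x + t *\<^sub>R axis i 1)) 0"

primrec iterated_pd :: "'n list \<Rightarrow> (real^'n \<Rightarrow> real) \<Rightarrow> real^'n \<Rightarrow> real" where
  "iterated_pd [] f = f"
| "iterated_pd (i # I) f = pd i (iterated_pd I f)"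

text \<open>For open \<open>S\<close> this is the class of \<open>C\<^sup>\<infinity>\<close> functions on \<open>S\<close>.
  Total differentiability of each iterated partial derivative provides the existence of the
  next ones and the continuity of all of them.\<close>

definition smooth_on :: "(real^'n) set \<Rightarrow> (real^'n \<Rightarrow> real) \<Rightarrow> bool" where
  "smooth_on S f \<longleftrightarrow> (\<forall>I. iterated_pd I f differentiable_on S)"


section \<open>Riemannian manifolds\<close>

type_synonym ('p, 'n) chart = "'p set \<times> ('p \<Rightarrow> real^'n)"

definition is_chart :: "'p topology \<Rightarrow> ('p, 'n::finite) chart \<Rightarrow> bool" where
  "is_chart X c \<longleftrightarrow> (case c of (U, \<phi>) \<Rightarrow>
     openin X U \<and> open (\<phi> ` U) \<and>
     homeomorphic_map (subtopology X U) (top_of_set (\<phi> ` U)) \<phi>)"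

text \<open>The \<open>a\<close>-th component of the coordinate change \<open>\<psi> \<circ> \<phi>\<^sup>-\<^sup>1\<close>, defined on \<open>\<phi> ` (U \<inter> V)\<close>.\<close>

definition transition ::
    "('p, 'n) chart \<Rightarrow> ('p, 'n) chart \<Rightarrow> 'n \<Rightarrow> real^'n \<Rightarrow> real" where
  "transition c d a x = snd d (inv_into (fst c) (snd c) x) $ a"

text \<open>The points of a manifold are the elements of \<open>topspace X\<close>, not of the whole type \<open>'p\<close>.
  A type into which \<open>\<real>\<^sup>n\<close> injects carries a copy of every second countable \<open>n\<close>-manifold, for
  \<open>n \<ge> 1\<close>. The atlas \<open>A\<close> is not required to be maximal.\<close>

definition smooth_manifold :: "'p topology \<Rightarrow> ('p, 'n::finite) chart set \<Rightarrow> bool" where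
  "smooth_manifold X A \<longleftrightarrow>
     Hausdorff_space X \<and> second_countable X \<and>
     (\<forall>c\<in>A. is_chart X c) \<and> (\<Union>c\<in>A. fst c) = topspace X \<and>
     (\<forall>c\<in>A. \<forall>d\<in>A. \<forall>a. smooth_on (snd c ` (fst c \<inter> fst d)) (transition c d a))"

text \<open>A metric is given by its component matrices \<open>g\<^sub>i\<^sub>j\<close> in every chart of the atlas, as
  functions of the coordinates of that chart; the components in different charts are related
  by the transformation law of covariant 2-tensors.\<close>

type_synonym ('p, 'n) metric = "('p, 'n) chart \<Rightarrow> real^'n \<Rightarrow> real^'n^'n"

definition riemannian_metric ::
    "('p, 'n::finite) chart set \<Rightarrow> ('p, 'n) metric \<Rightarrow> bool" where
  "riemannian_metric A g \<longleftrightarrow>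
     (\<forall>c\<in>A. \<forall>i j. smooth_on (snd c ` fst c) (\<lambda>x. g c x $ i $ j)) \<and>
     (\<forall>c\<in>A. \<forall>x\<in>snd c ` fst c.
        transpose (g c x) = g c x \<and> (\<forall>v. v \<noteq> 0 \<longrightarrow> v \<bullet> (g c x *v v) > 0)) \<and>
     (\<forall>c\<in>A. \<forall>d\<in>A. \<forall>p\<in>fst c \<inter> fst d. \<forall>i j.
        g c (snd c p) $ i $ j =
          (\<Sum>a\<in>UNIV. \<Sum>b\<in>UNIV.
             pd i (transition c d a) (snd c p) * pd j (transition c d b) (snd c p) *
             g d (snd d p) $ a $ b))"

definition riemannian_manifold ::
    "'p topology \<Rightarrow> ('p, 'n::finite) chart set \<Rightarrow> ('p, 'n) metric \<Rightarrow> bool" where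
  "riemannian_manifold X A g \<longleftrightarrow> smooth_manifold X A \<and> riemannian_metric A g"


section \<open>Curvature of a metric in coordinates\<close>

text \<open>Below \<open>G\<close> is the component matrix of a metric in one chart. Tensors are given by their
  components with respect to the coordinate frame; a trailing argument \<open>x\<close> is the coordinate
  vector of the point.\<close>

type_synonym 'n cmetric = "real^'n \<Rightarrow> real^'n^'n"

definition ginv :: "'n::finite cmetric \<Rightarrow> 'n \<Rightarrow> 'n \<Rightarrow> real^'n \<Rightarrow> real" where
  "ginv G i j x = matrix_inv (G x) $ i $ j"

text \<open>\<open>christoffel G k i j\<close> is \<open>\<Gamma>\<^sup>k\<^sub>i\<^sub>j\<close>.\<close>

definition christoffel :: "'n::finite cmetric \<Rightarrow> 'n \<Rightarrow> 'n \<Rightarrow> 'n \<Rightarrow> real^'n \<Rightarrow> real" where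
  "christoffel G k i j x = (1/2) * (\<Sum>l\<in>UNIV. ginv G k l x *
     (pd i (\<lambda>y. G y $ j $ l) x + pd j (\<lambda>y. G y $ i $ l) x - pd l (\<lambda>y. G y $ i $ j) x))"

text \<open>Covariant derivatives of covariant tensors of rank 1, 2, 3 for the Levi-Civita
  connection; the first index is the direction of differentiation.\<close>

definition cov1 :: "'n::finite cmetric \<Rightarrow> ('n \<Rightarrow> real^'n \<Rightarrow> real) \<Rightarrow>
    'n \<Rightarrow> 'n \<Rightarrow> real^'n \<Rightarrow> real" where
  "cov1 G T a i x = pd a (T i) x - (\<Sum>k\<in>UNIV. christoffel G k a i x * T k x)"

definition cov2 :: "'n::finite cmetric \<Rightarrow> ('n \<Rightarrow> 'n \<Rightarrow> real^'n \<Rightarrow> real) \<Rightarrow>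
    'n \<Rightarrow> 'n \<Rightarrow> 'n \<Rightarrow> real^'n \<Rightarrow> real" where
  "cov2 G T a i j x = pd a (T i j) x
     - (\<Sum>k\<in>UNIV. christoffel G k a i x * T k j x)
     - (\<Sum>k\<in>UNIV. christoffel G k a j x * T i k x)"

definition cov3 :: "'n::finite cmetric \<Rightarrow> ('n \<Rightarrow> 'n \<Rightarrow> 'n \<Rightarrow> real^'n \<Rightarrow> real) \<Rightarrow>
    'n \<Rightarrow> 'n \<Rightarrow> 'n \<Rightarrow> 'n \<Rightarrow> real^'n \<Rightarrow> real" where
  "cov3 G T a h i j x = pd a (T h i j) x
     - (\<Sum>k\<in>UNIV. christoffel G k a h x * T k i j x)
     - (\<Sum>k\<in>UNIV. christoffel G k a i x * T h k j x)
     - (\<Sum>k\<in>UNIV. christoffel G k a j x * T h i k x)"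

text \<open>\<open>riem_up G i j k l\<close> is the \<open>\<partial>\<^sub>l\<close>-component of
  \<open>\<nabla>\<^sub>i \<nabla>\<^sub>j \<partial>\<^sub>k - \<nabla>\<^sub>j \<nabla>\<^sub>i \<partial>\<^sub>k\<close>. With
  \<open>R\<^sub>i\<^sub>j\<^sub>k\<^sub>l = g(R(\<partial>\<^sub>i, \<partial>\<^sub>j) \<partial>\<^sub>k, \<partial>\<^sub>l)\<close> the value \<open>R\<^sub>a\<^sub>b\<^sub>b\<^sub>a\<close> on orthonormal
  vectors is the sectional curvature.\<close>

definition riem_up :: "'n::finite cmetric \<Rightarrow> 'n \<Rightarrow> 'n \<Rightarrow> 'n \<Rightarrow> 'n \<Rightarrow> real^'n \<Rightarrow> real" where
  "riem_up G i j k l x =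
     pd i (christoffel G l j k) x - pd j (christoffel G l i k) x
     + (\<Sum>m\<in>UNIV. christoffel G l i m x * christoffel G m j k x)
     - (\<Sum>m\<in>UNIV. christoffel G l j m x * christoffel G m i k x)"

definition riem :: "'n::finite cmetric \<Rightarrow> 'n \<Rightarrow> 'n \<Rightarrow> 'n \<Rightarrow> 'n \<Rightarrow> real^'n \<Rightarrow> real" where
  "riem G i j k l x = (\<Sum>m\<in>UNIV. G x $ m $ l * riem_up G i j k m x)"

definition ric :: "'n::finite cmetric \<Rightarrow> 'n \<Rightarrow> 'n \<Rightarrow> real^'n \<Rightarrow> real" where
  "ric G i j x = (\<Sum>a\<in>UNIV. \<Sum>b\<in>UNIV. ginv G a b x * riem G a i j b x)"

definition scal :: "'n::finite cmetric \<Rightarrow> real^'n \<Rightarrow> real" where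
  "scal G x = (\<Sum>i\<in>UNIV. \<Sum>j\<in>UNIV. ginv G i j x * ric G i j x)"

definition riem_norm2 :: "'n::finite cmetric \<Rightarrow> real^'n \<Rightarrow> real" where
  "riem_norm2 G x =
     (\<Sum>a\<in>UNIV. \<Sum>b\<in>UNIV. \<Sum>c\<in>UNIV. \<Sum>d\<in>UNIV.
      \<Sum>a'\<in>UNIV. \<Sum>b'\<in>UNIV. \<Sum>c'\<in>UNIV. \<Sum>d'\<in>UNIV.
        ginv G a a' x * ginv G b b' x * ginv G c c' x * ginv G d d' x *
        riem G a b c d x * riem G a' b' c' d' x)"

definition ric_norm2 :: "'n::finite cmetric \<Rightarrow> real^'n \<Rightarrow> real" where
  "ric_norm2 G x =
     (\<Sum>a\<in>UNIV. \<Sum>b\<in>UNIV. \<Sum>a'\<in>UNIV. \<Sum>b'\<in>UNIV.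
        ginv G a a' x * ginv G b b' x * ric G a b x * ric G a' b' x)"

definition riem_check :: "'n::finite cmetric \<Rightarrow> 'n \<Rightarrow> 'n \<Rightarrow> real^'n \<Rightarrow> real" where
  "riem_check G i j x =
     (\<Sum>a\<in>UNIV. \<Sum>b\<in>UNIV. \<Sum>c\<in>UNIV. \<Sum>a'\<in>UNIV. \<Sum>b'\<in>UNIV. \<Sum>c'\<in>UNIV.
        ginv G a a' x * ginv G b b' x * ginv G c c' x *
        riem G a b c i x * riem G a' b' c' j x)"

definition ric_check :: "'n::finite cmetric \<Rightarrow> 'n \<Rightarrow> 'n \<Rightarrow> real^'n \<Rightarrow> real" where
  "ric_check G i j x =
     (\<Sum>a\<in>UNIV. \<Sum>a'\<in>UNIV. ginv G a a' x * ric G a i x * ric G a' j x)"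

definition L_ric :: "'n::finite cmetric \<Rightarrow> 'n \<Rightarrow> 'n \<Rightarrow> real^'n \<Rightarrow> real" where
  "L_ric G i j x =
     2 * (\<Sum>a\<in>UNIV. \<Sum>b\<in>UNIV. \<Sum>a'\<in>UNIV. \<Sum>b'\<in>UNIV.
        ginv G a a' x * ginv G b b' x * riem G i a b j x * ric G a' b' x)"

definition hess_scal :: "'n::finite cmetric \<Rightarrow> 'n \<Rightarrow> 'n \<Rightarrow> real^'n \<Rightarrow> real" where
  "hess_scal G = cov1 G (\<lambda>i. pd i (scal G))"

definition lap_scal :: "'n::finite cmetric \<Rightarrow> real^'n \<Rightarrow> real" where
  "lap_scal G x = (\<Sum>i\<in>UNIV. \<Sum>j\<in>UNIV. ginv G i j x * hess_scal G i j x)"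

definition rough_lap_ric :: "'n::finite cmetric \<Rightarrow> 'n \<Rightarrow> 'n \<Rightarrow> real^'n \<Rightarrow> real" where
  "rough_lap_ric G i j x =
     (\<Sum>a\<in>UNIV. \<Sum>b\<in>UNIV. ginv G a b x * cov3 G (cov2 G (ric G)) a b i j x)"

end

(*
  (<=) Raising one index, the left-hand side becomes a quadratic expression in the mixed curvature
  tensor S_ab^cd = R_ab^cd, a multiple of the contraction of S S with the generalised Kronecker
  delta on five indices, which vanishes in dimension 4. Only the antisymmetry of S in ab and in cd
  is needed once the pair symmetry of R has been used to write the norms as contractions of S.

  (=>) The identity is evaluated at the origin of R^4 for the metrics
  dx1^2 + e^(2 f2) dx2^2 + e^(2 f3) dx3^2 + e^(2 f4) dx4^2, where the fi are functions of x1.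
  Only the last three terms see the fourth derivatives of the fi, so metrics with vanishing 3-jet
  at the origin force c8 = c9 = c10 = 0. Four choices of the 2-jets then leave a one-parameter
  family for c1, ..., c7.
*)

theory Submission
  imports Defs
begin

section \<open>Partial derivatives\<close>

text \<open>The frame is an arbitrary coordinate frame, so inverse metrics occur in every
  contraction. Each term of the identity has exactly one inverse metric fewer than its expression in
  mixed tensors requires. Raising the free index supplies it and turns the metric into the Kronecker
  delta, which leaves a polynomial identity between the components at a point. The pair symmetry of
  the curvature rests on the symmetry of second derivatives, which for \<open>pd\<close> has to be
  obtained from the mean value theorem.

  In the converse, dependence on one coordinate turns all derivatives into those of functions of one
  variable, and a diagonal curvature operator turns the seven quadratic terms into polynomials in
  the sectional curvatures of the six coordinate planes. The last test metric has at the origin the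
  curvature tensor of S^2 x H^2: K_14 = 1, K_23 = -1, and 0 for the other coordinate planes. Its
  scalar curvature vanishes there, so \<open>c3\<close> and \<open>c7\<close> drop out of the
  equation.\<close>

lemma pd_has_derivative:
  assumes "(f has_derivative f') (at x)"
  shows "pd i f x = f' (axis i 1)"
proof -
  have lin: "linear f'" using assms by (rule has_derivative_linear)
  have "((\<lambda>t. x + t *\<^sub>R axis i (1::real)) has_derivative (\<lambda>t. t *\<^sub>R axis i 1)) (at 0)"
    by (auto intro!: derivative_eq_intros)
  moreover have "(f has_derivative f') (at (x + 0 *\<^sub>R axis i (1::real)))" using assms by simp
  ultimately have "((\<lambda>t. f (x + t *\<^sub>R axis i 1)) has_derivative (\<lambda>t. f' (t *\<^sub>R axis i 1))) (at 0)"
    by (rule has_derivative_compose)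
  then have "((\<lambda>t. f (x + t *\<^sub>R axis i 1)) has_real_derivative f' (axis i 1)) (at 0)"
    using lin by (simp add: has_field_derivative_def linear_cmul mult_commute_abs)
  then show ?thesis unfolding pd_def by (rule DERIV_imp_deriv)
qed

text \<open>The form required by the mean value theorem: differentiability along a whole segment,
  not only at its base point.\<close>

lemma pd_line:
  assumes "f differentiable at (y + t *\<^sub>R axis i 1)"
  shows "((\<lambda>s. f (y + s *\<^sub>R axis i 1)) has_real_derivative pd i f (y + t *\<^sub>R axis i 1)) (at t)"
proof -
  let ?x = "y + t *\<^sub>R axis i (1::real)"
  obtain f' where f': "(f has_derivative f') (at ?x)"
    using assms by (auto simp: differentiable_def)
  have lin: "linear f'" using f' by (rule has_derivative_linear)
  have "((\<lambda>s. y + s *\<^sub>R axis i (1::real)) has_derivative (\<lambda>s. s *\<^sub>R axis i 1)) (at t)"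
    by (auto intro!: derivative_eq_intros)
  from has_derivative_compose[OF this f'] show ?thesis
    using lin by (simp add: has_field_derivative_def linear_cmul mult_commute_abs pd_has_derivative[OF f'])
qed

text \<open>Allows the differentiation of formulas that are known only on the chart image, such as
  the symmetry of the metric.\<close>

lemma pd_cong:
  assumes "open S" "x \<in> S" "\<And>y. y \<in> S \<Longrightarrow> f y = g y"
  shows "pd i f x = pd i g x"
proof -
  have "continuous_on UNIV (\<lambda>t::real. x + t *\<^sub>R axis i 1)" by (intro continuous_intros)
  then have "open ((\<lambda>t::real. x + t *\<^sub>R axis i 1) -` S)"
    using assms(1) by (rule open_vimage[rotated])
  then have "eventually (\<lambda>t. t \<in> (\<lambda>t::real. x + t *\<^sub>R axis i 1) -` S) (nhds 0)"
    using assms(2) by (intro eventually_nhds_in_open) auto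
  then have "eventually (\<lambda>t. f (x + t *\<^sub>R axis i 1) = g (x + t *\<^sub>R axis i 1)) (nhds 0)"
    by (rule eventually_mono) (use assms(3) in auto)
  then show ?thesis unfolding pd_def by (intro deriv_cong_ev) auto
qed

lemma pd_const [simp]: "pd i (\<lambda>x. c) x = 0"
  by (simp add: pd_def)

lemma pd_add:
  assumes "f differentiable at x" "g differentiable at x"
  shows "pd i (\<lambda>y. f y + g y) x = pd i f x + pd i g x"
  using assms by (auto simp: differentiable_def pd_has_derivative pd_has_derivative[OF has_derivative_add])

lemma pd_diff:
  assumes "f differentiable at x" "g differentiable at x"
  shows "pd i (\<lambda>y. f y - g y) x = pd i f x - pd i g x"
  using assms by (auto simp: differentiable_def pd_has_derivative pd_has_derivative[OF has_derivative_diff])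

lemma pd_mult:
  assumes "f differentiable at x" "g differentiable at x"
  shows "pd i (\<lambda>y. f y * g y) x = pd i f x * g x + f x * pd i g x"
  using assms
  by (auto simp: differentiable_def pd_has_derivative pd_has_derivative[OF has_derivative_mult])

lemma pd_cmult:
  assumes "f differentiable at x"
  shows "pd i (\<lambda>y. c * f y) x = c * pd i f x"
  using pd_mult[OF differentiable_const assms] by simp

lemma pd_sum:
  assumes "finite I" "\<And>k. k \<in> I \<Longrightarrow> f k differentiable at x"
  shows "pd i (\<lambda>y. \<Sum>k\<in>I. f k y) x = (\<Sum>k\<in>I. pd i (f k) x)"
  using assms
proof (induction I rule: finite_induct)
  case (insert a I)
  then show ?case by (simp add: pd_add differentiable_sum)
qed simp

lemma smooth_on_iterated_pd:
  assumes "smooth_on S f" "open S" "x \<in> S"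
  shows "iterated_pd I f differentiable at x"
  using assms by (auto simp: smooth_on_def differentiable_on_eq_differentiable_at)

lemma smooth_on_differentiable:
  assumes "smooth_on S f" "open S" "x \<in> S"
  shows "f differentiable at x" "pd i f differentiable at x" "pd i (pd j f) differentiable at x"
  using smooth_on_iterated_pd[OF assms, of "[]"] smooth_on_iterated_pd[OF assms, of "[i]"]
    smooth_on_iterated_pd[OF assms, of "[i, j]"] by simp_all

text \<open>The mean value theorem is applied twice: in direction \<open>i\<close> to the difference
  of \<open>f\<close> along two parallel segments, then in direction \<open>j\<close> to
  \<open>pd i f\<close>. The second difference on the left is symmetric in \<open>i\<close> and
  \<open>j\<close>, which is what \<open>pd_commute\<close> exploits.\<close>

lemma mixed_difference_mvt:
  fixes f :: "real^'n::finite \<Rightarrow> real"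
  assumes f: "smooth_on S f" and S: "open S" and "0 < h"
    and inS: "\<And>s t. \<bar>s\<bar> \<le> h \<Longrightarrow> \<bar>t\<bar> \<le> h \<Longrightarrow> x + s *\<^sub>R axis i 1 + t *\<^sub>R axis j 1 \<in> S"
  obtains s t where "0 < s" "s < h" "0 < t" "t < h"
    "f (x + h *\<^sub>R axis i 1 + h *\<^sub>R axis j 1) - f (x + h *\<^sub>R axis i 1) -
       f (x + h *\<^sub>R axis j 1) + f x =
     h * h * pd j (pd i f) (x + s *\<^sub>R axis i 1 + t *\<^sub>R axis j 1)"
proof -
  let ?a = "axis i (1::real) :: real^'n" and ?b = "axis j (1::real) :: real^'n"
  define \<phi> where "\<phi> s = f (x + h *\<^sub>R ?b + s *\<^sub>R ?a) - f (x + s *\<^sub>R ?a)" for s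
  have "\<exists>s>0. s < h \<and> \<phi> h - \<phi> 0 =
      (h - 0) * (pd i f (x + h *\<^sub>R ?b + s *\<^sub>R ?a) - pd i f (x + s *\<^sub>R ?a))"
  proof (rule MVT2[OF \<open>0 < h\<close>])
    fix s assume s: "0 \<le> s" "s \<le> h"
    have "x + h *\<^sub>R ?b + s *\<^sub>R ?a \<in> S" using inS[of s h] s by (simp add: algebra_simps)
    moreover have "x + s *\<^sub>R ?a \<in> S" using inS[of s 0] s by simp
    ultimately show "(\<phi> has_real_derivative
        pd i f (x + h *\<^sub>R ?b + s *\<^sub>R ?a) - pd i f (x + s *\<^sub>R ?a)) (at s)"
      unfolding \<phi>_def
      by (intro DERIV_diff pd_line smooth_on_differentiable(1)[OF f S])
  qed
  then obtain s where s: "0 < s" "s < h" and 1: "\<phi> h - \<phi> 0 =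
      h * (pd i f (x + s *\<^sub>R ?a + h *\<^sub>R ?b) - pd i f (x + s *\<^sub>R ?a + 0 *\<^sub>R ?b))"
    by (auto simp: algebra_simps)
  have "\<exists>t>0. t < h \<and>
      pd i f (x + s *\<^sub>R ?a + h *\<^sub>R ?b) - pd i f (x + s *\<^sub>R ?a + 0 *\<^sub>R ?b) =
      (h - 0) * pd j (pd i f) (x + s *\<^sub>R ?a + t *\<^sub>R ?b)"
  proof (rule MVT2[OF \<open>0 < h\<close>])
    fix t assume t: "0 \<le> t" "t \<le> h"
    have "x + s *\<^sub>R ?a + t *\<^sub>R ?b \<in> S" using inS[of s t] s t by simp
    then show "((\<lambda>t. pd i f (x + s *\<^sub>R ?a + t *\<^sub>R ?b)) has_real_derivative
        pd j (pd i f) (x + s *\<^sub>R ?a + t *\<^sub>R ?b)) (at t)"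
      by (intro pd_line smooth_on_differentiable(2)[OF f S])
  qed
  then obtain t where t: "0 < t" "t < h" and
    2: "pd i f (x + s *\<^sub>R ?a + h *\<^sub>R ?b) - pd i f (x + s *\<^sub>R ?a + 0 *\<^sub>R ?b) =
      h * pd j (pd i f) (x + s *\<^sub>R ?a + t *\<^sub>R ?b)" by auto
  show ?thesis
    by (rule that[OF s t]) (use 1 2 in \<open>simp add: \<phi>_def algebra_simps\<close>)
qed

text \<open>Both orders of differentiation represent the same second difference, so the two mixed
  derivatives agree at some pair of points near \<open>x\<close>. Continuity of both at
  \<open>x\<close> then bounds their difference there by any \<open>e > 0\<close>.\<close>

lemma pd_commute:
  fixes f :: "real^'n::finite \<Rightarrow> real"
  assumes f: "smooth_on S f" and S: "open S" and x: "x \<in> S"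
  shows "pd i (pd j f) x = pd j (pd i f) x"
proof -
  have "\<bar>pd i (pd j f) x - pd j (pd i f) x\<bar> \<le> e" if "e > 0" for e :: real
  proof -
    have "isCont (pd i (pd j f)) x" "isCont (pd j (pd i f)) x"
      using smooth_on_differentiable(3)[OF f S x] differentiable_imp_continuous_within by blast+
    then have "\<exists>d>0. \<forall>y. dist y x < d \<longrightarrow> dist (pd i (pd j f) y) (pd i (pd j f) x) < e/2"
        "\<exists>d>0. \<forall>y. dist y x < d \<longrightarrow> dist (pd j (pd i f) y) (pd j (pd i f) x) < e/2"
      using \<open>e > 0\<close> unfolding continuous_at_eps_delta by (meson half_gt_zero)+
    then obtain d1 d2 where d: "d1 > 0" "d2 > 0"
      "\<And>y. dist y x < d1 \<Longrightarrow> dist (pd i (pd j f) y) (pd i (pd j f) x) < e/2"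
      "\<And>y. dist y x < d2 \<Longrightarrow> dist (pd j (pd i f) y) (pd j (pd i f) x) < e/2"
      by blast
    obtain d3 where d3: "d3 > 0" "ball x d3 \<subseteq> S" using S x openE by blast
    \<comment> \<open>A third of the smallest radius, because points of the square of side
      \<open>h\<close> are only known to lie within \<open>2 * h\<close> of
      \<open>x\<close>.\<close>
    define h where "h = min (min d1 d2) d3 / 3"
    have h: "0 < h" using d d3 by (simp add: h_def)
    have h3: "h + h < min (min d1 d2) d3"
      using h unfolding h_def by linarith
    have near: "dist (x + s *\<^sub>R axis k 1 + t *\<^sub>R axis l 1) x < min (min d1 d2) d3"
      if "\<bar>s\<bar> \<le> h" "\<bar>t\<bar> \<le> h" for s t and k l :: 'n
    proof -
      have "dist (x + s *\<^sub>R axis k 1 + t *\<^sub>R axis l 1) x = norm (s *\<^sub>R axis k (1::real) + t *\<^sub>R axis l 1)"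
        by (simp add: dist_norm algebra_simps)
      also have "\<dots> \<le> \<bar>s\<bar> + \<bar>t\<bar>"
        by (rule norm_triangle_le) simp
      also have "\<dots> < min (min d1 d2) d3" using that h3 by linarith
      finally show ?thesis .
    qed
    have inS: "x + s *\<^sub>R axis k 1 + t *\<^sub>R axis l 1 \<in> S"
      if "\<bar>s\<bar> \<le> h" "\<bar>t\<bar> \<le> h" for s t and k l :: 'n
      using near[OF that, of k l] d3 by (auto simp: subset_iff dist_commute)
    obtain s t where st: "0 < s" "s < h" "0 < t" "t < h"
      "f (x + h *\<^sub>R axis i 1 + h *\<^sub>R axis j 1) - f (x + h *\<^sub>R axis i 1) -
         f (x + h *\<^sub>R axis j 1) + f x =
       h * h * pd j (pd i f) (x + s *\<^sub>R axis i 1 + t *\<^sub>R axis j 1)"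
      using mixed_difference_mvt[OF f S h inS] by blast
    obtain s' t' where st': "0 < s'" "s' < h" "0 < t'" "t' < h"
      "f (x + h *\<^sub>R axis j 1 + h *\<^sub>R axis i 1) - f (x + h *\<^sub>R axis j 1) -
         f (x + h *\<^sub>R axis i 1) + f x =
       h * h * pd i (pd j f) (x + s' *\<^sub>R axis j 1 + t' *\<^sub>R axis i 1)"
      using mixed_difference_mvt[OF f S h inS] by blast
    have "h * h * pd j (pd i f) (x + s *\<^sub>R axis i 1 + t *\<^sub>R axis j 1) =
        h * h * pd i (pd j f) (x + s' *\<^sub>R axis j 1 + t' *\<^sub>R axis i 1)"
      unfolding st(5)[symmetric] st'(5)[symmetric] by (simp add: algebra_simps)
    then have eq: "pd j (pd i f) (x + s *\<^sub>R axis i 1 + t *\<^sub>R axis j 1) =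
        pd i (pd j f) (x + s' *\<^sub>R axis j 1 + t' *\<^sub>R axis i 1)" using h by simp
    have "dist (pd j (pd i f) (x + s *\<^sub>R axis i 1 + t *\<^sub>R axis j 1)) (pd j (pd i f) x) < e/2"
      by (rule d(4)) (use near[of s t i j] st(1-4) in linarith)
    moreover have "dist (pd i (pd j f) (x + s' *\<^sub>R axis j 1 + t' *\<^sub>R axis i 1))
        (pd i (pd j f) x) < e/2"
      by (rule d(3)) (use near[of s' t' j i] st'(1-4) in linarith)
    ultimately show ?thesis unfolding eq dist_real_def by linarith
  qed
  then show ?thesis
    by (metis dense_ge abs_le_zero_iff eq_iff_diff_eq_0)
qed

section \<open>Determinants and the inverse matrix\<close>

lemma differentiable_prod:
  fixes f :: "'i \<Rightarrow> 'a::real_normed_vector \<Rightarrow> real"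
  assumes "finite I" "\<And>k. k \<in> I \<Longrightarrow> f k differentiable at x"
  shows "(\<lambda>y. \<Prod>k\<in>I. f k y) differentiable at x"
  using assms by (induction I rule: finite_induct) auto

lemma differentiable_det:
  fixes A :: "'a::real_normed_vector \<Rightarrow> real^'n::finite^'n"
  assumes "\<And>i j. (\<lambda>y. A y $ i $ j) differentiable at x"
  shows "(\<lambda>y. det (A y)) differentiable at x"
  unfolding det_def
  by (intro differentiable_sum differentiable_mult differentiable_const differentiable_prod assms
      ballI finite_permutations finite)

lemma matrix_inv_mult:
  fixes A :: "real^'n::finite^'n"
  assumes "invertible A"
  shows matrix_inv_right: "A ** matrix_inv A = mat 1"
    and matrix_inv_left: "matrix_inv A ** A = mat 1"
proof -
  have "A ** matrix_inv A = mat 1 \<and> matrix_inv A ** A = mat 1"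
    unfolding matrix_inv_def using assms unfolding invertible_def by (rule someI_ex)
  then show "A ** matrix_inv A = mat 1" "matrix_inv A ** A = mat 1" by auto
qed

text \<open>Cramer's rule exhibits the entries of the inverse as quotients of determinants, from
  which the differentiability of \<open>ginv\<close> is read off.\<close>

lemma matrix_inv_cramer:
  fixes A :: "real^'n::finite^'n"
  assumes "det A \<noteq> 0"
  shows "matrix_inv A $ k $ l =
    det (\<chi> i j. if j = k then axis l 1 $ i else A $ i $ j) / det A"
proof -
  have "invertible A" using assms by (simp add: invertible_det_nz)
  then have "A *v (matrix_inv A *v axis l 1) = axis l 1"
    by (simp add: matrix_vector_mul_assoc matrix_inv_right)
  then have "matrix_inv A *v axis l 1 =
      (\<chi> k. det (\<chi> i j. if j = k then axis l 1 $ i else A $ i $ j) / det A)"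
    using cramer[OF assms] by blast
  then have "(matrix_inv A *v axis l 1) $ k =
      det (\<chi> i j. if j = k then axis l 1 $ i else A $ i $ j) / det A" by simp
  then show ?thesis by (simp add: matrix_vector_mult_basis column_def)
qed

section \<open>Symmetries of the curvature tensor\<close>

text \<open>A single chart suffices for the identity, which is an equation between components at one
  point.\<close>

locale coordinate_metric =
  fixes S :: "(real^'n::finite) set" and G :: "'n cmetric"
  assumes openS: "open S"
    and smooth: "\<And>i j. smooth_on S (\<lambda>x. G x $ i $ j)"
    and sym: "\<And>x i j. x \<in> S \<Longrightarrow> G x $ i $ j = G x $ j $ i"
    and pos: "\<And>x v. x \<in> S \<Longrightarrow> v \<noteq> 0 \<Longrightarrow> v \<bullet> (G x *v v) > 0"
begin

lemma invertible_metric: "x \<in> S \<Longrightarrow> invertible (G x)"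
  unfolding invertible_left_inverse matrix_left_invertible_ker
  using pos by (metis inner_zero_right less_irrefl)

lemma metric_ginv:
  assumes "x \<in> S"
  shows "(\<Sum>k\<in>UNIV. G x $ i $ k * ginv G k j x) = (if i = j then 1 else 0)"
proof -
  have "(G x ** matrix_inv (G x)) $ i $ j = mat 1 $ i $ j"
    using matrix_inv_right[OF invertible_metric[OF assms]] by simp
  then show ?thesis by (simp add: matrix_matrix_mult_def mat_def ginv_def)
qed

lemma ginv_metric:
  assumes "x \<in> S"
  shows "(\<Sum>k\<in>UNIV. ginv G i k x * G x $ k $ j) = (if i = j then 1 else 0)"
proof -
  have "(matrix_inv (G x) ** G x) $ i $ j = mat 1 $ i $ j"
    using matrix_inv_left[OF invertible_metric[OF assms]] by simp
  then show ?thesis by (simp add: matrix_matrix_mult_def mat_def ginv_def)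
qed

lemma ginv_sym:
  assumes "x \<in> S"
  shows "ginv G i j x = ginv G j i x"
proof -
  have "transpose (G x) = G x" using sym[OF assms] by (simp add: transpose_def vec_eq_iff)
  then have "transpose (matrix_inv (G x)) ** G x = mat 1"
    using matrix_inv_right[OF invertible_metric[OF assms]]
    by (metis matrix_transpose_mul transpose_mat)
  then have "transpose (matrix_inv (G x)) = matrix_inv (G x)"
    by (metis matrix_inv_right[OF invertible_metric[OF assms]] matrix_mul_assoc
        matrix_mul_lid matrix_mul_rid)
  then have "transpose (matrix_inv (G x)) $ i $ j = matrix_inv (G x) $ i $ j" by simp
  then show ?thesis by (simp add: transpose_def ginv_def)
qed

lemma metric_differentiable:
  assumes "x \<in> S"
  shows "(\<lambda>y. G y $ i $ j) differentiable at x"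
    "pd k (\<lambda>y. G y $ i $ j) differentiable at x"
  using smooth_on_differentiable[OF smooth openS assms] by blast+

lemma ginv_differentiable:
  assumes "x \<in> S"
  shows "ginv G k l differentiable at x"
proof -
  let ?f = "\<lambda>y. det (\<chi> i j. if j = k then axis l 1 $ i else G y $ i $ j) / det (G y)"
  have "?f differentiable at x"
  proof (rule differentiable_divide)
    show "(\<lambda>y. det (\<chi> i j. if j = k then axis l 1 $ i else G y $ i $ j)) differentiable at x"
    proof (rule differentiable_det)
      fix i j
      show "(\<lambda>y. (\<chi> i j. if j = k then axis l 1 $ i else G y $ i $ j) $ i $ j) differentiable at x"
        using metric_differentiable(1)[OF assms] by (cases "j = k") simp_all
    qed
    show "(\<lambda>y. det (G y)) differentiable at x"
      by (rule differentiable_det) (rule metric_differentiable(1)[OF assms])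
    show "det (G x) \<noteq> 0" using invertible_metric[OF assms] by (simp add: invertible_det_nz)
  qed
  then obtain D where "(?f has_derivative D) (at x)" by (auto simp: differentiable_def)
  then have "(ginv G k l has_derivative D) (at x)"
  proof (rule has_derivative_transform_within_open[OF _ openS assms])
    fix y assume "y \<in> S"
    then show "?f y = ginv G k l y"
      using invertible_metric by (simp add: ginv_def matrix_inv_cramer invertible_det_nz)
  qed
  then show ?thesis by (auto simp: differentiable_def)
qed

text \<open>Christoffel symbols of the first kind. They are free of the inverse metric, so their
  derivatives involve only second derivatives of the metric.\<close>

definition christoffel_low :: "'n \<Rightarrow> 'n \<Rightarrow> 'n \<Rightarrow> real^'n \<Rightarrow> real" where
  "christoffel_low i j l x = (1/2) *
     (pd i (\<lambda>y. G y $ j $ l) x + pd j (\<lambda>y. G y $ i $ l) x - pd l (\<lambda>y. G y $ i $ j) x)"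

lemma christoffel_eq: "christoffel G k i j x = (\<Sum>l\<in>UNIV. ginv G k l x * christoffel_low i j l x)"
  by (simp add: christoffel_def christoffel_low_def sum_distrib_left algebra_simps)

lemma lower_christoffel:
  assumes "x \<in> S"
  shows "(\<Sum>m\<in>UNIV. G x $ m $ l * christoffel G m i j x) = christoffel_low i j l x"
proof -
  have "(\<Sum>m\<in>UNIV. G x $ m $ l * christoffel G m i j x) =
      (\<Sum>m\<in>UNIV. \<Sum>k\<in>UNIV. G x $ l $ m * ginv G m k x * christoffel_low i j k x)"
    using sym[OF assms] by (simp add: christoffel_eq sum_distrib_left mult.assoc)
  also have "\<dots> = (\<Sum>k\<in>UNIV. (\<Sum>m\<in>UNIV. G x $ l $ m * ginv G m k x) * christoffel_low i j k x)"
    by (subst sum.swap) (simp add: sum_distrib_right)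
  also have "\<dots> = christoffel_low i j l x"
    by (simp add: metric_ginv[OF assms] if_distrib[of "\<lambda>z. z * _"] cong: if_cong)
  finally show ?thesis .
qed

lemma christoffel_low_differentiable:
  assumes "x \<in> S"
  shows "christoffel_low i j l differentiable at x"
  unfolding christoffel_low_def[abs_def]
  by (intro differentiable_mult differentiable_const differentiable_add differentiable_diff
      metric_differentiable[OF assms])

lemma christoffel_differentiable:
  assumes "x \<in> S"
  shows "christoffel G k i j differentiable at x"
  unfolding christoffel_eq[abs_def]
  by (intro differentiable_sum differentiable_mult ginv_differentiable[OF assms]
      christoffel_low_differentiable[OF assms] ballI finite)

text \<open>Compatibility of the Levi-Civita connection with the metric.\<close>

lemma pd_metric:
  assumes "x \<in> S"
  shows "pd i (\<lambda>y. G y $ m $ l) x = christoffel_low i m l x + christoffel_low i l m x"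
proof -
  have "pd i (\<lambda>y. G y $ l $ m) x = pd i (\<lambda>y. G y $ m $ l) x"
    by (rule pd_cong[OF openS assms]) (rule sym)
  then show ?thesis unfolding christoffel_low_def by (simp add: field_simps)
qed

text \<open>The inner product of the covariant derivative of the \<open>l\<close>-th coordinate
  field along the \<open>i\<close>-th with that of the \<open>k\<close>-th along the
  \<open>j\<close>-th. Its symmetries are those of a symmetric form and of a torsion-free
  connection.\<close>

definition christoffel_prod :: "'n \<Rightarrow> 'n \<Rightarrow> 'n \<Rightarrow> 'n \<Rightarrow> real^'n \<Rightarrow> real" where
  "christoffel_prod i l j k x =
     (\<Sum>m\<in>UNIV. christoffel_low i l m x * christoffel G m j k x)"

lemma christoffel_low_sym: "x \<in> S \<Longrightarrow> christoffel_low i j l x = christoffel_low j i l x"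
  unfolding christoffel_low_def
  using pd_cong[OF openS, of x "\<lambda>y. G y $ i $ j" "\<lambda>y. G y $ j $ i" l] sym by simp

lemma christoffel_prod_sym:
  assumes "x \<in> S"
  shows "christoffel_prod i l j k x = christoffel_prod l i j k x"
    "christoffel_prod i l j k x = christoffel_prod i l k j x"
    "christoffel_prod i l j k x = christoffel_prod j k i l x"
proof -
  show "christoffel_prod i l j k x = christoffel_prod l i j k x"
    unfolding christoffel_prod_def by (simp add: christoffel_low_sym[OF assms, of i l])
  show "christoffel_prod i l j k x = christoffel_prod i l k j x"
    unfolding christoffel_prod_def christoffel_eq
    by (simp add: christoffel_low_sym[OF assms, of j k])
  show "christoffel_prod i l j k x = christoffel_prod j k i l x"
    unfolding christoffel_prod_def christoffel_eq sum_distrib_left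
    by (subst sum.swap) (simp add: ginv_sym[OF assms] mult_ac)
qed

text \<open>The product rule applied to \<open>lower_christoffel\<close>, so that the inverse metric
  is never differentiated explicitly.\<close>

lemma lower_pd_christoffel:
  assumes "x \<in> S"
  shows "(\<Sum>m\<in>UNIV. G x $ m $ l * pd i (christoffel G m j k) x) =
    pd i (christoffel_low j k l) x
      - (\<Sum>m\<in>UNIV. pd i (\<lambda>y. G y $ m $ l) x * christoffel G m j k x)"
proof -
  have "pd i (christoffel_low j k l) x =
      pd i (\<lambda>y. \<Sum>m\<in>UNIV. G y $ m $ l * christoffel G m j k y) x"
    by (rule pd_cong[OF openS assms]) (simp add: lower_christoffel)
  also have "\<dots> = (\<Sum>m\<in>UNIV. pd i (\<lambda>y. G y $ m $ l) x * christoffel G m j k x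
      + G x $ m $ l * pd i (christoffel G m j k) x)"
    by (subst pd_sum) (auto simp: pd_mult metric_differentiable[OF assms]
        christoffel_differentiable[OF assms])
  finally show ?thesis by (simp add: sum.distrib)
qed

text \<open>By \<open>pd_metric\<close>, differentiating the lowering metric yields two quadratic
  terms for each order of \<open>i\<close> and \<open>j\<close>. One of them cancels the quadratic
  term of \<open>riem_up\<close>, the other is a \<open>christoffel_prod\<close>.\<close>

lemma riem_eq:
  assumes x: "x \<in> S"
  shows "riem G i j k l x =
    pd i (christoffel_low j k l) x - pd j (christoffel_low i k l) x
    - christoffel_prod i l j k x + christoffel_prod j l i k x"
proof -
  have *: "(\<Sum>m\<in>UNIV. G x $ m $ l * (\<Sum>n\<in>UNIV. christoffel G m i n x * christoffel G n j k x)) =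
      (\<Sum>n\<in>UNIV. christoffel_low i n l x * christoffel G n j k x)" for i j
    by (subst lower_christoffel[OF x, symmetric])
      (simp add: sum_distrib_left sum_distrib_right mult.assoc, rule sum.swap)
  have "riem G i j k l x =
      (\<Sum>m\<in>UNIV. G x $ m $ l * pd i (christoffel G m j k) x)
      - (\<Sum>m\<in>UNIV. G x $ m $ l * pd j (christoffel G m i k) x)
      + (\<Sum>m\<in>UNIV. G x $ m $ l * (\<Sum>n\<in>UNIV. christoffel G m i n x * christoffel G n j k x))
      - (\<Sum>m\<in>UNIV. G x $ m $ l * (\<Sum>n\<in>UNIV. christoffel G m j n x * christoffel G n i k x))"
    unfolding riem_def riem_up_def
    by (simp add: sum.distrib sum_subtractf algebra_simps)
  then show ?thesis
    unfolding * lower_pd_christoffel[OF x] pd_metric[OF x] christoffel_prod_def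
    by (simp add: sum.distrib algebra_simps)
qed

lemma pd_christoffel_low:
  assumes x: "x \<in> S"
  shows "pd i (christoffel_low j k l) x = (1/2) *
    (pd i (pd j (\<lambda>y. G y $ k $ l)) x + pd i (pd k (\<lambda>y. G y $ j $ l)) x
     - pd i (pd l (\<lambda>y. G y $ j $ k)) x)"
  unfolding christoffel_low_def[abs_def]
  by (subst pd_cmult pd_diff pd_add;
      (intro differentiable_add differentiable_diff metric_differentiable[OF x])?)+ simp

text \<open>After \<open>riem_eq\<close> this is linear algebra: \<open>H\<close> is symmetric in
  its first pair because partial derivatives commute and in its second because the metric is
  symmetric, and \<open>Q\<close> has the symmetries of \<open>christoffel_prod\<close>.\<close>

lemma riem_sym:
  assumes x: "x \<in> S"
  shows "riem G i j k l x = - riem G j i k l x"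
    "riem G i j k l x = - riem G i j l k x"
    "riem G i j k l x = riem G k l i j x"
proof -
  define H where "H a b k l = pd a (pd b (\<lambda>y. G y $ k $ l)) x" for a b k l
  define Q where "Q a b c d = christoffel_prod a b c d x" for a b c d
  have R: "riem G i j k l x = (1/2) * (H i j k l + H i k j l - H i l j k)
      - (1/2) * (H j i k l + H j k i l - H j l i k) - Q i l j k + Q j l i k" for i j k l
    unfolding riem_eq[OF x] pd_christoffel_low[OF x] H_def Q_def ..
  have c: "H a b k l = H b a k l" for a b k l
    unfolding H_def by (rule pd_commute[OF smooth openS x])
  have "pd b (\<lambda>y. G y $ k $ l) y = pd b (\<lambda>y. G y $ l $ k) y" if "y \<in> S" for b k l y
    by (rule pd_cong[OF openS that]) (rule sym)
  then have s: "H a b k l = H a b l k" for a b k l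
    unfolding H_def by (rule pd_cong[OF openS x])
  note q = christoffel_prod_sym[OF x, folded Q_def]
  show "riem G i j k l x = - riem G j i k l x"
    unfolding R by simp
  show "riem G i j k l x = - riem G i j l k x"
    unfolding R using q(3)[of i l j k] q(3)[of i k j l] c[of i j k l] c[of i j l k]
    by (simp add: field_simps)
  show "riem G i j k l x = riem G k l i j x"
    unfolding R
    using c[of i j k l] c[of k l i j] c[of i k j l] s[of k i j l] c[of j l i k] s[of l j i k]
      c[of i l j k] s[of l i j k] c[of j k i l] s[of k j i l]
      q(3)[of k j l i] q(2)[of l i k j] q(1)[of l i j k] q(1)[of l j k i] q(2)[of j l k i]
    by (simp add: field_simps)
qed

end

section \<open>The identity in dimension 4\<close>

text \<open>The left-hand side is the expansion of the contraction
  \<open>\<delta>\<^sup>j\<^sup>a\<^sup>b\<^sup>c\<^sup>d\<^sub>i\<^sub>p\<^sub>q\<^sub>r\<^sub>s S\<^sub>a\<^sub>b\<^sup>p\<^sup>q S\<^sub>c\<^sub>d\<^sup>r\<^sup>s\<close>, where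
  \<open>S a b c d\<close> stands for \<open>S\<^sub>a\<^sub>b\<^sup>c\<^sup>d\<close>.\<close>

lemma curvature_identity_mixed:
  fixes S :: "4 \<Rightarrow> 4 \<Rightarrow> 4 \<Rightarrow> 4 \<Rightarrow> real"
  assumes low: "\<And>a b c d. S a b c d = - S b a c d"
    and up: "\<And>a b c d. S a b c d = - S a b d c"
  defines "P \<equiv> \<lambda>i j. \<Sum>a\<in>UNIV. S i a a j"
  shows "((\<Sum>a\<in>UNIV. \<Sum>b\<in>UNIV. \<Sum>c\<in>UNIV. \<Sum>d\<in>UNIV. S a b c d * S c d a b)
      - 4 * (\<Sum>a\<in>UNIV. \<Sum>b\<in>UNIV. P a b * P b a) + (\<Sum>a\<in>UNIV. P a a)\<^sup>2) * (if i = j then 1 else 0)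
    - 4 * (\<Sum>a\<in>UNIV. \<Sum>b\<in>UNIV. \<Sum>c\<in>UNIV. S c i a b * S a b c j)
    + 8 * (\<Sum>a\<in>UNIV. P i a * P a j)
    + 8 * (\<Sum>a\<in>UNIV. \<Sum>b\<in>UNIV. S i a b j * P b a)
    - 4 * (\<Sum>a\<in>UNIV. P a a) * P i j = 0"
proof -
  have z: "S a a c d = 0" "S a b c c = 0" for a b c d
    using low[of a a c d] up[of a b c c] by simp_all
  \<comment> \<open>As directed rewrite rules these sort both index pairs, and \<open>z\<close>
    removes repeated indices. What remains for each \<open>i\<close>, \<open>j\<close> is a
    polynomial identity in the 36 components with increasing pairs.\<close>
  note l = low[of 2 1] low[of 3 1] low[of 4 1] low[of 3 2] low[of 4 2] low[of 4 3]
  note u = up[of _ _ 2 1] up[of _ _ 3 1] up[of _ _ 4 1] up[of _ _ 3 2] up[of _ _ 4 2] up[of _ _ 4 3]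
  have P: "P i j = S i 1 1 j + S i 2 2 j + S i 3 3 j + S i 4 4 j" for i j
    by (simp add: P_def sum_4)
  show ?thesis
    using exhaust_4[of i] exhaust_4[of j] unfolding sum_4 P
    by (elim disjE; hypsubst; simp add: z l u; simp add: power2_eq_square algebra_simps)
qed

text \<open>A sum over tuples lets any permutation of contracted indices be carried out as one
  reindexing by a bijection.\<close>

lemma sum_nested2:
  "(\<Sum>a\<in>UNIV. \<Sum>b\<in>UNIV. f a b) = (\<Sum>(a, b)\<in>UNIV. f a b)"
  by (simp only: sum.cartesian_product UNIV_Times_UNIV)

lemma sum_nested3:
  "(\<Sum>a\<in>UNIV. \<Sum>b\<in>UNIV. \<Sum>c\<in>UNIV. F a b c) =
    (\<Sum>(a, b, c)\<in>UNIV. F a b c)"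
  by (rule trans[OF sum.cong[OF refl sum_nested2] sum_nested2])

lemma sum_nested4:
  "(\<Sum>a\<in>UNIV. \<Sum>b\<in>UNIV. \<Sum>c\<in>UNIV. \<Sum>d\<in>UNIV. F a b c d) =
    (\<Sum>(a, b, c, d)\<in>UNIV. F a b c d)"
  by (rule trans[OF sum.cong[OF refl sum_nested3] sum_nested2])

lemma sum_nested5:
  "(\<Sum>a\<in>UNIV. \<Sum>b\<in>UNIV. \<Sum>c\<in>UNIV. \<Sum>d\<in>UNIV. \<Sum>e\<in>UNIV. F a b c d e) =
    (\<Sum>(a, b, c, d, e)\<in>UNIV. F a b c d e)"
  by (rule trans[OF sum.cong[OF refl sum_nested4] sum_nested2])

lemma sum_nested6:
  "(\<Sum>a\<in>UNIV. \<Sum>b\<in>UNIV. \<Sum>c\<in>UNIV. \<Sum>d\<in>UNIV. \<Sum>e\<in>UNIV. \<Sum>f\<in>UNIV. F a b c d e f) =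
    (\<Sum>(a, b, c, d, e, f)\<in>UNIV. F a b c d e f)"
  by (rule trans[OF sum.cong[OF refl sum_nested5] sum_nested2])

lemma sum_nested7:
  "(\<Sum>a\<in>UNIV. \<Sum>b\<in>UNIV. \<Sum>c\<in>UNIV. \<Sum>d\<in>UNIV. \<Sum>e\<in>UNIV. \<Sum>f\<in>UNIV. \<Sum>g\<in>UNIV. F a b c d e f g) =
    (\<Sum>(a, b, c, d, e, f, g)\<in>UNIV. F a b c d e f g)"
  by (rule trans[OF sum.cong[OF refl sum_nested6] sum_nested2])

lemma sum_nested8:
  "(\<Sum>a\<in>UNIV. \<Sum>b\<in>UNIV. \<Sum>c\<in>UNIV. \<Sum>d\<in>UNIV. \<Sum>e\<in>UNIV. \<Sum>f\<in>UNIV. \<Sum>g\<in>UNIV. \<Sum>h\<in>UNIV. F a b c d e f g h) =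
    (\<Sum>(a, b, c, d, e, f, g, h)\<in>UNIV. F a b c d e f g h)"
  by (rule trans[OF sum.cong[OF refl sum_nested7] sum_nested2])

section \<open>Contractions expressed through the mixed curvature tensor\<close>

context coordinate_metric begin

definition riem_mixed :: "real^'n \<Rightarrow> 'n \<Rightarrow> 'n \<Rightarrow> 'n \<Rightarrow> 'n \<Rightarrow> real" where
  "riem_mixed x a b c d = (\<Sum>k\<in>UNIV. \<Sum>l\<in>UNIV. ginv G k c x * ginv G l d x * riem G a b k l x)"

definition ric_mixed :: "real^'n \<Rightarrow> 'n \<Rightarrow> 'n \<Rightarrow> real" where
  "ric_mixed x i j = (\<Sum>a\<in>UNIV. riem_mixed x i a a j)"

lemma riem_mixed_sym:
  assumes x: "x \<in> S"
  shows "riem_mixed x a b c d = - riem_mixed x b a c d"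
    "riem_mixed x a b c d = - riem_mixed x a b d c"
proof -
  show "riem_mixed x a b c d = - riem_mixed x b a c d"
    unfolding riem_mixed_def by (subst riem_sym(1)[OF x]) (simp add: sum_negf)
  have "riem_mixed x a b c d =
      (\<Sum>l\<in>UNIV. \<Sum>k\<in>UNIV. ginv G k c x * ginv G l d x * riem G a b k l x)"
    unfolding riem_mixed_def by (rule sum.swap)
  also have "\<dots> = (\<Sum>l\<in>UNIV. \<Sum>k\<in>UNIV. - (ginv G l d x * ginv G k c x * riem G a b l k x))"
    by (intro sum.cong refl, subst riem_sym(2)[OF x]) simp
  finally show "riem_mixed x a b c d = - riem_mixed x a b d c"
    by (simp add: riem_mixed_def sum_negf)
qed

text \<open>The pair symmetry followed by both antisymmetries exchanges R_aijb with R_bjia, and the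
  trace is symmetric in a and b.\<close>

lemma ric_sym:
  assumes x: "x \<in> S"
  shows "ric G i j x = ric G j i x"
proof -
  have *: "riem G a i j b x = riem G b j i a x" for a b
    using riem_sym(3)[OF x, of a i j b] riem_sym(1)[OF x, of j b a i] riem_sym(2)[OF x, of b j a i]
    by simp
  have "ric G i j x = (\<Sum>b\<in>UNIV. \<Sum>a\<in>UNIV. ginv G a b x * riem G b j i a x)"
    unfolding ric_def * by (rule sum.swap)
  also have "\<dots> = ric G j i x"
    unfolding ric_def by (intro sum.cong refl, subst ginv_sym[OF x]) simp
  finally show ?thesis .
qed

lemma ric_mixed_eq:
  assumes x: "x \<in> S"
  shows "ric_mixed x i j = (\<Sum>k\<in>UNIV. ginv G k j x * ric G i k x)"
proof -
  have 1: "ginv G k a x * riem G i a k l x = ginv G a k x * riem G a i l k x" for a k l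
    using riem_sym(1)[OF x, of i a k l] riem_sym(2)[OF x, of a i k l] ginv_sym[OF x, of k a]
    by simp
  have *: "ginv G k a x * ginv G l j x * riem G i a k l x =
      ginv G l j x * (ginv G a k x * riem G a i l k x)" for a k l
    using arg_cong[OF 1, of "\<lambda>z. ginv G l j x * z"] by (simp add: mult_ac)
  show ?thesis
    unfolding ric_mixed_def riem_mixed_def * ric_def
    apply (simp only: sum_distrib_left sum_distrib_right)
    unfolding sum_nested3
    by (rule sum.reindex_bij_witness[where j = "\<lambda>(a, k, l). (l, a, k)"
          and i = "\<lambda>(l, a, k). (a, k, l)"])
      (auto simp: mult_ac)
qed

lemma scal_eq:
  assumes x: "x \<in> S"
  shows "scal G x = (\<Sum>a\<in>UNIV. ric_mixed x a a)"
  unfolding scal_def ric_mixed_eq[OF x]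
  by (intro sum.cong refl, subst ginv_sym[OF x]) simp

lemma ric_norm2_eq:
  assumes x: "x \<in> S"
  shows "ric_norm2 G x = (\<Sum>a\<in>UNIV. \<Sum>b\<in>UNIV. ric_mixed x a b * ric_mixed x b a)"
  unfolding ric_norm2_def ric_mixed_eq[OF x]
  apply (simp only: sum_distrib_left sum_distrib_right)
  unfolding sum_nested4
    by (rule sum.reindex_bij_witness[where j = "\<lambda>(a, b, a', b'). (a, b', a', b)"
          and i = "\<lambda>(a, b', a', b). (a, b, a', b')"])
      (auto simp: ginv_sym[OF x] ric_sym[OF x] mult_ac)

lemma riem_norm2_eq:
  assumes x: "x \<in> S"
  shows "riem_norm2 G x = (\<Sum>a\<in>UNIV. \<Sum>b\<in>UNIV. \<Sum>c\<in>UNIV. \<Sum>d\<in>UNIV.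
    riem_mixed x a b c d * riem_mixed x c d a b)"
  unfolding riem_norm2_def riem_mixed_def
  apply (simp only: sum_distrib_left sum_distrib_right)
  unfolding sum_nested8
    by (rule sum.reindex_bij_witness[where j = "\<lambda>(a, b, c, d, a', b', c', d'). (a, b, c', d', a', b', c, d)"
          and i = "\<lambda>(a, b, c', d', a', b', c, d). (a, b, c, d, a', b', c', d')"])
      (auto simp: ginv_sym[OF x] riem_sym(3)[OF x] mult_ac)

text \<open>The three inverse metrics of \<open>riem_check\<close> and the one raising
  \<open>j\<close> are the four contained in two mixed curvature tensors.\<close>

lemma riem_check_raise:
  assumes x: "x \<in> S"
  shows "(\<Sum>j\<in>UNIV. ginv G j k x * riem_check G i j x) =
    (\<Sum>a\<in>UNIV. \<Sum>b\<in>UNIV. \<Sum>c\<in>UNIV. riem_mixed x c i a b * riem_mixed x a b c k)"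
  unfolding riem_check_def riem_mixed_def 
  apply (simp only: sum_distrib_left sum_distrib_right)
  unfolding sum_nested7
    \<comment> \<open>Fixing \<open>i\<close> as last index confines the pair symmetry to the factor
      carrying \<open>i\<close>, which it moves to second place as in
      \<open>riem_mixed x c i a b\<close>.\<close>
    by (rule sum.reindex_bij_witness[where j = "\<lambda>(j, a, b, c, a', b', c'). (a', b', c, c', j, a, b)"
          and i = "\<lambda>(a', b', c, c', j, a, b). (j, a, b, c, a', b', c')"])
      (auto simp: ginv_sym[OF x] riem_sym(3)[OF x, of _ _ _ i] mult_ac)

lemma ric_check_raise:
  assumes x: "x \<in> S"
  shows "(\<Sum>j\<in>UNIV. ginv G j k x * ric_check G i j x) =
    (\<Sum>a\<in>UNIV. ric_mixed x i a * ric_mixed x a k)"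
  unfolding ric_check_def ric_mixed_eq[OF x] 
  apply (simp only: sum_distrib_left sum_distrib_right)
  unfolding sum_nested3
    by (rule sum.reindex_bij_witness[where j = "\<lambda>(j, a, a'). (a', j, a)"
          and i = "\<lambda>(a', j, a). (j, a, a')"])
      (auto simp: ginv_sym[OF x] ric_sym[OF x] mult_ac)

lemma L_ric_raise:
  assumes x: "x \<in> S"
  shows "(\<Sum>j\<in>UNIV. ginv G j k x * L_ric G i j x) =
    2 * (\<Sum>a\<in>UNIV. \<Sum>b\<in>UNIV. riem_mixed x i a b k * ric_mixed x b a)"
  unfolding L_ric_def ric_mixed_eq[OF x] riem_mixed_def
  apply (simp only: sum_distrib_left sum_distrib_right)
  unfolding sum_nested5
    by (rule sum.reindex_bij_witness[where j = "\<lambda>(j, a, b, a', b'). (a, b', a', b, j)"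
          and i = "\<lambda>(a, b', a', b, j). (j, a, b, a', b')"])
      (auto simp: ginv_sym[OF x] ric_sym[OF x] mult_ac)
end

lemma curvature_identity_coordinates:
  fixes G :: "4 cmetric"
  assumes "coordinate_metric S G" and x: "x \<in> S"
  shows "1/4 * (riem_norm2 G x - 4 * ric_norm2 G x + (scal G x)\<^sup>2) * G x $ i $ j
    - riem_check G i j x + 2 * ric_check G i j x + L_ric G i j x - scal G x * ric G i j x = 0"
proof -
  interpret coordinate_metric S G by fact
  \<comment> \<open>Four times the asserted expression, which matches the integer coefficients of
    \<open>curvature_identity_mixed\<close>.\<close>
  define E where "E i j = (riem_norm2 G x - 4 * ric_norm2 G x + (scal G x)\<^sup>2) * G x $ i $ j
    - 4 * riem_check G i j x + 8 * ric_check G i j x + 4 * L_ric G i j x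
    - 4 * scal G x * ric G i j x" for i j
  have ginv_E: "(\<Sum>j\<in>UNIV. ginv G j k x * E i j) = 0" for i k
  proof -
    have delta: "(\<Sum>j\<in>UNIV. ginv G j k x * G x $ i $ j) = (if i = k then 1 else 0)"
      using metric_ginv[OF x, of i k] by (simp add: mult.commute)
    have "(\<Sum>j\<in>UNIV. ginv G j k x * E i j) =
        (riem_norm2 G x - 4 * ric_norm2 G x + (scal G x)\<^sup>2) * (\<Sum>j\<in>UNIV. ginv G j k x * G x $ i $ j)
        - 4 * (\<Sum>j\<in>UNIV. ginv G j k x * riem_check G i j x)
        + 8 * (\<Sum>j\<in>UNIV. ginv G j k x * ric_check G i j x)
        + 4 * (\<Sum>j\<in>UNIV. ginv G j k x * L_ric G i j x)
        - 4 * scal G x * (\<Sum>j\<in>UNIV. ginv G j k x * ric G i j x)"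
      by (simp add: E_def sum_distrib_left sum.distrib sum_subtractf algebra_simps)
    also have "\<dots> = 0"
      unfolding delta riem_check_raise[OF x] ric_check_raise[OF x] L_ric_raise[OF x]
        ric_mixed_eq[OF x, symmetric] scal_eq[OF x] ric_norm2_eq[OF x] riem_norm2_eq[OF x]
      using curvature_identity_mixed[of "riem_mixed x" i k, OF riem_mixed_sym[OF x]]
      unfolding ric_mixed_def by simp
    finally show ?thesis .
  qed
  \<comment> \<open>Lowering the raised index again recovers \<open>E\<close>, since the metric
    inverts \<open>ginv\<close>.\<close>
  have "E i j = (\<Sum>l\<in>UNIV. (if l = j then 1 else 0) * E i l)"
    by (simp add: if_distrib[of "\<lambda>z. z * _"] cong: if_cong)
  also have "\<dots> = (\<Sum>l\<in>UNIV. \<Sum>k\<in>UNIV. G x $ k $ j * (ginv G l k x * E i l))"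
    unfolding ginv_metric[OF x, symmetric] sum_distrib_right by (simp add: mult_ac)
  also have "\<dots> = (\<Sum>k\<in>UNIV. G x $ k $ j * (\<Sum>l\<in>UNIV. ginv G l k x * E i l))"
    by (subst sum.swap) (simp add: sum_distrib_left)
  also have "\<dots> = 0" by (simp add: ginv_E)
  finally show ?thesis by (simp add: E_def field_simps)
qed

lemma riemannian_metric_coordinates:
  fixes A :: "('p, 'n::finite) chart set"
  assumes A: "riemannian_manifold X A g" and c: "c \<in> A"
  shows "coordinate_metric (snd c ` fst c) (g c)"
proof
  show "open (snd c ` fst c)"
    using A c by (auto simp: riemannian_manifold_def smooth_manifold_def is_chart_def split: prod.splits)
  fix i j :: 'n
  show "smooth_on (snd c ` fst c) (\<lambda>x. g c x $ i $ j)"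
    using A c by (auto simp: riemannian_manifold_def riemannian_metric_def)
next
  fix x v and i j :: 'n assume x: "x \<in> snd c ` fst c"
  have "transpose (g c x) = g c x"
    using A c x by (auto simp: riemannian_manifold_def riemannian_metric_def)
  then have "transpose (g c x) $ i $ j = g c x $ i $ j" by simp
  then show "g c x $ i $ j = g c x $ j $ i" by (simp add: transpose_def)
  show "v \<bullet> (g c x *v v) > 0" if "v \<noteq> 0"
    using A c x that by (auto simp: riemannian_manifold_def riemannian_metric_def)
qed

section \<open>Metrics on a global chart\<close>

text \<open>Closure under differentiation reduces the smoothness of a function of one coordinate to an
  induction over the iterated partial derivatives.\<close>

inductive_set elementary :: "(real \<Rightarrow> real) set" where
  const: "(\<lambda>t. c) \<in> elementary"
| ident: "(\<lambda>t. t) \<in> elementary"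
| add: "F \<in> elementary \<Longrightarrow> H \<in> elementary \<Longrightarrow> (\<lambda>t. F t + H t) \<in> elementary"
| mult: "F \<in> elementary \<Longrightarrow> H \<in> elementary \<Longrightarrow> (\<lambda>t. F t * H t) \<in> elementary"
| exp: "F \<in> elementary \<Longrightarrow> (\<lambda>t. exp (F t)) \<in> elementary"

lemma elementary_derivative:
  assumes "F \<in> elementary"
  obtains F' where "F' \<in> elementary" "\<And>t. (F has_real_derivative F' t) (at t)"
proof -
  have "\<exists>F'\<in>elementary. \<forall>t. (F has_real_derivative F' t) (at t)"
    using assms
  proof induction
    case (const c)
    show ?case by (rule bexI[OF _ elementary.const[of 0]]) simp
  next
    case ident
    show ?case by (rule bexI[OF _ elementary.const[of 1]]) simp
  next
    case (add F H)
    then obtain F' H' where "F' \<in> elementary" "H' \<in> elementary"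
      "\<forall>t. (F has_real_derivative F' t) (at t)" "\<forall>t. (H has_real_derivative H' t) (at t)" by blast
    then show ?case
      by (intro bexI[of _ "\<lambda>t. F' t + H' t"]) (auto intro!: derivative_intros elementary.add)
  next
    case (mult F H)
    then obtain F' H' where *: "F' \<in> elementary" "H' \<in> elementary"
      "\<forall>t. (F has_real_derivative F' t) (at t)" "\<forall>t. (H has_real_derivative H' t) (at t)" by blast
    then show ?case
      by (intro bexI[of _ "\<lambda>t. F' t * H t + H' t * F t"])
        (auto intro!: DERIV_mult elementary.add elementary.mult mult)
  next
    case (exp F)
    then obtain F' where "F' \<in> elementary"
      "\<forall>t. (F has_real_derivative F' t) (at t)" by blast
    then show ?case
      by (intro bexI[of _ "\<lambda>t. exp (F t) * F' t"])
        (auto intro!: DERIV_fun_exp elementary.mult elementary.exp exp)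
  qed
  then show ?thesis using that by blast
qed

lemma has_derivative_coordinate:
  fixes x :: "real^'n::finite"
  assumes "(F has_real_derivative D) (at (x $ a))"
  shows "((\<lambda>x. F (x $ a)) has_derivative (\<lambda>h. D * h $ a)) (at x)"
proof -
  have "((\<lambda>x. x $ a) has_derivative (\<lambda>h. h $ a)) (at x)"
    by (rule bounded_linear_imp_has_derivative) (rule bounded_linear_vec_nth)
  moreover have "(F has_derivative (*) D) (at (x $ a))"
    using assms by (simp add: has_field_derivative_def)
  ultimately show ?thesis by (rule has_derivative_compose)
qed

lemma pd_coordinate:
  fixes x :: "real^'n::finite"
  assumes "(F has_real_derivative D) (at (x $ a))"
  shows "pd i (\<lambda>x. F (x $ a)) x = (if i = a then D else 0)"
  by (simp add: pd_has_derivative[OF has_derivative_coordinate[OF assms]] axis_def)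

lemma smooth_on_elementary:
  fixes a :: "'n::finite"
  assumes "F \<in> elementary"
  shows "smooth_on S (\<lambda>x. F (x $ a))"
proof -
  have *: "\<exists>F'\<in>elementary. iterated_pd I (\<lambda>x. F (x $ a)) = (\<lambda>x. F' (x $ a))" for I
  proof (induction I)
    case Nil
    show ?case using assms by auto
  next
    case (Cons i I)
    then obtain H where H: "H \<in> elementary" "iterated_pd I (\<lambda>x. F (x $ a)) = (\<lambda>x. H (x $ a))"
      by blast
    obtain H' where H': "H' \<in> elementary" "\<And>t. (H has_real_derivative H' t) (at t)"
      using elementary_derivative[OF H(1)] by blast
    show ?case
    proof (cases "i = a")
      case True
      then show ?thesis using H'(1)
        by (intro bexI[of _ H']) (simp_all add: H(2) fun_eq_iff pd_coordinate[OF H'(2)])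
    next
      case False
      then show ?thesis 
        by (intro bexI[of _ "\<lambda>t. 0"])
          (simp_all add: H(2) fun_eq_iff pd_coordinate[OF H'(2)] elementary.const)
    qed
  qed
  have "(\<lambda>x. H (x $ a)) differentiable_on S" if "H \<in> elementary" for H
    using elementary_derivative[OF that] has_derivative_coordinate
    by (metis differentiable_at_imp_differentiable_on differentiable_def)
  then show ?thesis unfolding smooth_on_def using * by metis
qed

text \<open>The manifolds in question have their points in \<open>'p\<close>, so a metric on the
  coordinate space is transplanted along an injection, with the topology that makes
  \<open>inv emb\<close> a homeomorphism. The only coordinate change is the identity, which reduces
  the transformation law to Kronecker deltas.\<close>

lemma global_chart_manifold:
  fixes emb :: "real^'n::finite \<Rightarrow> 'p" and G :: "'n cmetric"
  defines "X \<equiv> pullback_topology (range emb) (inv emb) euclidean"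
    and "A \<equiv> {(range emb, inv emb)}"
  assumes emb: "inj emb"
    and smooth: "\<And>i j. smooth_on UNIV (\<lambda>x. G x $ i $ j)"
    and sym: "\<And>x. transpose (G x) = G x"
    and pos: "\<And>x v. v \<noteq> 0 \<Longrightarrow> v \<bullet> (G x *v v) > 0"
  shows "topspace X = range emb" "riemannian_manifold X A (\<lambda>_. G)"
proof -
  show top: "topspace X = range emb"
    by (simp add: X_def topspace_pullback_topology)
  have img: "inv emb ` range emb = UNIV"
    using emb by (auto simp: image_image)
  have hom: "homeomorphic_map X euclidean (inv emb)"
  proof (rule bijective_open_imp_homeomorphic_map)
    show "continuous_map X euclidean (inv emb)"
      using continuous_map_pullback[OF continuous_map_id, where A = "range emb" and f = "inv emb"]
      by (simp add: X_def)
    show "open_map X euclidean (inv emb)"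
      unfolding open_map_def
    proof (intro allI impI)
      fix U assume "openin X U"
      then obtain V where V: "open V" "U = inv emb -` V \<inter> range emb"
        by (auto simp: X_def openin_pullback_topology)
      have "inv emb ` U = V"
        unfolding V(2) using emb by (force simp: image_iff)
      then show "openin euclidean (inv emb ` U)" using V by simp
    qed
    show "inv emb ` topspace X = topspace euclidean" using img top by simp
    show "inj_on (inv emb) (topspace X)"
      unfolding top by (auto simp: inj_on_def inv_f_f[OF emb])
  qed
  then have homs: "X homeomorphic_space (euclidean :: (real^'n) topology)"
    by (rule homeomorphic_map_imp_homeomorphic_space)
  have chart: "is_chart X (range emb, inv emb)"
    using hom img openin_topspace[of X] by (simp add: is_chart_def top flip: top)
  have "second_countable (euclidean :: (real^'n) topology)"
  proof -
    obtain B :: "(real^'n) set set" where B: "countable B" "\<And>C. C \<in> B \<Longrightarrow> open C"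
      "\<And>S. open S \<Longrightarrow> \<exists>U. U \<subseteq> B \<and> S = \<Union>U"
      using univ_second_countable by blast
    have "\<exists>V\<in>B. x \<in> V \<and> V \<subseteq> U" if "open U" "x \<in> U" for U x
      using B(3)[OF that(1)] that(2) by blast
    then show ?thesis unfolding second_countable_def using B(1,2) by auto
  qed
  then have sc: "second_countable X"
    using homeomorphic_space_second_countability[OF homs] by simp
  have haus: "Hausdorff_space X"
    using homeomorphic_Hausdorff_space[OF homs] by simp
  have trans: "transition (range emb, inv emb) (range emb, inv emb) a = (\<lambda>x. x $ a)" for a
  proof
    fix x
    have "x \<in> inv emb ` range emb" using img by simp
    then show "transition (range emb, inv emb) (range emb, inv emb) a x = x $ a"
      unfolding transition_def by (simp add: f_inv_into_f)
  qed
  have pd_trans: "pd i (\<lambda>x. x $ a) x = (if i = a then 1 else 0)" for i a and x :: "real^'n"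
    using pd_coordinate[of "\<lambda>t. t" 1 x a i] by simp
  have "smooth_manifold X A"
    using haus sc chart top
    by (simp add: smooth_manifold_def A_def trans smooth_on_elementary[OF elementary.ident])
  moreover have "riemannian_metric A (\<lambda>_. G)"
    using smooth sym pos
    by (simp add: riemannian_metric_def A_def img trans pd_trans if_distrib[of "\<lambda>z. z * _"]
        if_distrib[of "\<lambda>z. _ * z"] cong: if_cong)
  ultimately show "riemannian_manifold X A (\<lambda>_. G)"
    by (simp add: riemannian_manifold_def)
qed

section \<open>Warped metrics\<close>

text \<open>The condition on \<open>f 1\<close> makes the first coordinate vector a unit vector
  while all four directions share the same formulas.\<close>

locale warped_metric =
  fixes f f' f'' :: "4 \<Rightarrow> real \<Rightarrow> real"
  assumes f_deriv: "\<And>i t. (f i has_real_derivative f' i t) (at t)"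
    and f'_deriv: "\<And>i t. (f' i has_real_derivative f'' i t) (at t)"
    and f_1: "f 1 = (\<lambda>t. 0)" "f' 1 = (\<lambda>t. 0)" "f'' 1 = (\<lambda>t. 0)"
begin

definition G :: "4 cmetric" where
  "G x = (\<chi> i j. if i = j then exp (2 * f i (x $ 1)) else 0)"

lemma G_nth: "G x $ i $ j = (if i = j then exp (2 * f i (x $ 1)) else 0)"
  by (simp add: G_def)

lemma transpose_G: "transpose (G x) = G x"
  by (auto simp: transpose_def G_nth vec_eq_iff)

lemma G_pos:
  assumes "v \<noteq> 0"
  shows "v \<bullet> (G x *v v) > 0"
proof -
  obtain k where k: "v $ k \<noteq> 0" using assms by (auto simp: vec_eq_iff)
  have "v \<bullet> (G x *v v) = (\<Sum>i\<in>UNIV. exp (2 * f i (x $ 1)) * (v $ i)\<^sup>2)"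
    by (simp add: inner_vec_def matrix_vector_mult_def G_nth if_distrib[of "\<lambda>z. z * _"]
        cong: if_cong) (simp add: power2_eq_square mult_ac)
  also have "\<dots> > 0"
    by (rule sum_pos2[of _ k]) (use k in auto)
  finally show ?thesis .
qed

lemma ginv_G: "ginv G i j x = (if i = j then exp (- 2 * f i (x $ 1)) else 0)"
proof -
  define B :: "real^4^4" where "B = (\<chi> i j. if i = j then exp (- 2 * f i (x $ 1)) else 0)"
  have "G x ** B = mat 1" "B ** G x = mat 1"
    by (auto simp: vec_eq_iff matrix_matrix_mult_def mat_def G_nth B_def
        if_distrib[of "\<lambda>z. z * _"] if_distrib[of "\<lambda>z. _ * z"] simp flip: exp_add cong: if_cong)
  moreover from this have "invertible (G x)" unfolding invertible_def by blast
  ultimately have "matrix_inv (G x) = B"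
    by (metis matrix_inv_right matrix_mul_assoc matrix_mul_lid matrix_mul_rid)
  then show ?thesis by (simp add: ginv_def B_def)
qed

lemma pd_G:
  "pd k (\<lambda>y. G y $ i $ j) x = (if k = 1 \<and> i = j then 2 * f' i (x $ 1) * exp (2 * f i (x $ 1)) else 0)"
proof (cases "i = j")
  case True
  have "((\<lambda>t. exp (2 * f i t)) has_real_derivative 2 * f' i (x $ 1) * exp (2 * f i (x $ 1))) (at (x $ 1))"
    by (rule derivative_eq_intros f_deriv refl | simp)+
  from pd_coordinate[OF this, of k] True show ?thesis by (simp add: G_nth)
next
  case False
  then show ?thesis by (simp add: G_nth)
qed

text \<open>The three cases overlap only for \<open>i = j = k = 1\<close>, where every term vanishes
  because \<open>f' 1\<close> does.\<close>

lemma christoffel_G: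
  "christoffel G k i j x =
    (if i = 1 \<and> j = k then f' k (x $ 1) else 0) + (if j = 1 \<and> i = k then f' k (x $ 1) else 0)
    - (if k = 1 \<and> i = j then f' i (x $ 1) * exp (2 * f i (x $ 1)) else 0)"
proof -
  have "christoffel G k i j x = (1/2) * (exp (- 2 * f k (x $ 1)) *
     (pd i (\<lambda>y. G y $ j $ k) x + pd j (\<lambda>y. G y $ i $ k) x - pd k (\<lambda>y. G y $ i $ j) x))"
    unfolding christoffel_def ginv_G by (simp add: if_distrib[of "\<lambda>z. z * _"] cong: if_cong)
  then show ?thesis
    unfolding pd_G using f_1
    by (auto simp: exp_minus field_simps)
qed

lemma pd_christoffel_G:
  "pd m (christoffel G k i j) x = (if m = 1 then
    (if i = 1 \<and> j = k then f'' k (x $ 1) else 0) + (if j = 1 \<and> i = k then f'' k (x $ 1) else 0)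
    - (if k = 1 \<and> i = j then (f'' i (x $ 1) + 2 * (f' i (x $ 1))\<^sup>2) * exp (2 * f i (x $ 1)) else 0)
    else 0)"
proof -
  let ?F = "\<lambda>t. (if i = 1 \<and> j = k then f' k t else 0) + (if j = 1 \<and> i = k then f' k t else 0)
    - (if k = 1 \<and> i = j then f' i t * exp (2 * f i t) else 0)"
  have 1: "christoffel G k i j = (\<lambda>x. ?F (x $ 1))"
    by (rule ext) (rule christoffel_G)
  have 2: "((\<lambda>t. if P then f' k t else 0) has_real_derivative (if P then f'' k t else 0)) (at t)" for P k t
    using f'_deriv by auto
  have "((\<lambda>t. f' i t * exp (2 * f i t)) has_real_derivative
      (f'' i t + 2 * (f' i t)\<^sup>2) * exp (2 * f i t)) (at t)" for t
    by (rule derivative_eq_intros f_deriv f'_deriv refl | simp add: power2_eq_square algebra_simps)+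
  then have 3: "((\<lambda>t. if P then f' i t * exp (2 * f i t) else 0) has_real_derivative
      (if P then (f'' i t + 2 * (f' i t)\<^sup>2) * exp (2 * f i t) else 0)) (at t)" for P t
    by auto
  show ?thesis
    unfolding 1 by (rule pd_coordinate) (intro DERIV_diff DERIV_add 2 3)
qed

text \<open>Sectional curvatures of the coordinate planes. Those containing the first direction are
  -h''/h for the warping function h = exp f. The others come from the Gauss equation of the flat
  slices of constant x1, whose principal curvatures are the \<open>f' i\<close> up to a common sign.
  The value 0 for \<open>i = j\<close> allows sums over all indices.\<close>

definition sectional :: "4 \<Rightarrow> 4 \<Rightarrow> real \<Rightarrow> real" where
  "sectional i j t = (if i = j then 0
     else if i = 1 then - (f'' j t + (f' j t)\<^sup>2)
     else if j = 1 then - (f'' i t + (f' i t)\<^sup>2)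
     else - (f' i t * f' j t))"

text \<open>The curvature operator is diagonal in the coordinate planes, so sectional curvatures
  determine the whole tensor.\<close>

lemma riem_G:
  "riem G i j k l x = sectional i j (x $ 1) * exp (2 * f i (x $ 1)) * exp (2 * f j (x $ 1)) *
    ((if i = l \<and> j = k then 1 else 0) - (if i = k \<and> j = l then 1 else 0))"
proof -
  have 1: "riem G i j k l x = exp (2 * f l (x $ 1)) * riem_up G i j k l x"
    unfolding riem_def G_nth by (simp add: if_distrib[of "\<lambda>z. z * _"] cong: if_cong)
  show ?thesis
    unfolding 1 riem_up_def pd_christoffel_G christoffel_G sectional_def sum_4
    using exhaust_4[of i] exhaust_4[of j] exhaust_4[of k] exhaust_4[of l]
    by (elim disjE; hypsubst; simp add: f_1 power2_eq_square algebra_simps)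
qed

end

section \<open>Values of the invariants at the origin\<close>

definition curvature_combination ::
    "real \<Rightarrow> real \<Rightarrow> real \<Rightarrow> real \<Rightarrow> real \<Rightarrow> real \<Rightarrow> real \<Rightarrow> real \<Rightarrow> real \<Rightarrow> real \<Rightarrow>
     'n::finite cmetric \<Rightarrow> 'n \<Rightarrow> 'n \<Rightarrow> real^'n \<Rightarrow> real" where
  "curvature_combination c1 c2 c3 c4 c5 c6 c7 c8 c9 c10 G i j x =
     c1 * riem_norm2 G x * G x $ i $ j + c2 * ric_norm2 G x * G x $ i $ j
     + c3 * (scal G x)\<^sup>2 * G x $ i $ j + c4 * riem_check G i j x
     + c5 * ric_check G i j x + c6 * L_ric G i j x + c7 * scal G x * ric G i j x
     + c8 * lap_scal G x * G x $ i $ j + c9 * hess_scal G i j x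
     + c10 * rough_lap_ric G i j x"

lemma sum_delta_mult:
  fixes F :: "'n::finite \<Rightarrow> real"
  shows "(\<Sum>b\<in>UNIV. (if a = b then 1 else 0) * F b) = F a"
  by (simp add: if_distrib[of "\<lambda>z. z * _"] cong: if_cong)

lemma orthonormal_contractions:
  fixes G :: "'n::finite cmetric"
  assumes G: "\<And>i j. ginv G i j x = (if i = j then 1 else 0)"
  shows "riem_norm2 G x = (\<Sum>a\<in>UNIV. \<Sum>b\<in>UNIV. \<Sum>c\<in>UNIV. \<Sum>d\<in>UNIV. (riem G a b c d x)\<^sup>2)"
    "ric_norm2 G x = (\<Sum>a\<in>UNIV. \<Sum>b\<in>UNIV. (ric G a b x)\<^sup>2)"
    "riem_check G i j x = (\<Sum>a\<in>UNIV. \<Sum>b\<in>UNIV. \<Sum>c\<in>UNIV. riem G a b c i x * riem G a b c j x)"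
    "ric_check G i j x = (\<Sum>a\<in>UNIV. ric G a i x * ric G a j x)"
    "L_ric G i j x = 2 * (\<Sum>a\<in>UNIV. \<Sum>b\<in>UNIV. riem G i a b j x * ric G a b x)"
    "lap_scal G x = (\<Sum>a\<in>UNIV. hess_scal G a a x)"
    "rough_lap_ric G i j x = (\<Sum>a\<in>UNIV. cov3 G (cov2 G (ric G)) a a i j x)"
  unfolding riem_norm2_def ric_norm2_def riem_check_def ric_check_def L_ric_def lap_scal_def
    rough_lap_ric_def G
  \<comment> \<open>Pulling the factors independent of the innermost index out of its sum leaves a
    single delta next to it, so the sums collapse from the inside.\<close>
  by (simp_all only: mult.assoc sum_distrib_left[symmetric] sum_delta_mult power2_eq_square)

context warped_metric
begin

definition ric_dir :: "4 \<Rightarrow> real \<Rightarrow> real" where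
  "ric_dir i t = (\<Sum>a\<in>UNIV. sectional a i t)"

lemma sectional_sym: "sectional i j t = sectional j i t"
  by (auto simp: sectional_def)

lemma sectional_refl [simp]: "sectional i i t = 0"
  by (simp add: sectional_def)

lemma ric_G: "ric G i j x = (if i = j then ric_dir i (x $ 1) * exp (2 * f i (x $ 1)) else 0)"
proof -
  have "ric G i j x = (\<Sum>a\<in>UNIV. exp (- 2 * f a (x $ 1)) * riem G a i j a x)"
    unfolding ric_def ginv_G by (simp add: if_distrib[of "\<lambda>z. z * _"] cong: if_cong)
  also have "\<dots> = (\<Sum>a\<in>UNIV. if i = j then sectional a i (x $ 1) * exp (2 * f i (x $ 1)) else 0)"
  proof (intro sum.cong refl)
    fix a
    have "exp (- 2 * f a (x $ 1)) * riem G a i j a x =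
        (exp (- 2 * f a (x $ 1)) * exp (2 * f a (x $ 1))) * (sectional a i (x $ 1) * exp (2 * f i (x $ 1)) *
          ((if i = j then 1 else 0) - (if a = j \<and> i = a then 1 else 0)))"
      by (simp only: riem_G) simp
    also have "exp (- 2 * f a (x $ 1)) * exp (2 * f a (x $ 1)) = 1"
      by (simp flip: exp_add)
    finally show "exp (- 2 * f a (x $ 1)) * riem G a i j a x =
        (if i = j then sectional a i (x $ 1) * exp (2 * f i (x $ 1)) else 0)"
      by (cases "a = i") auto
  qed
  finally show ?thesis by (cases "i = j") (simp_all add: ric_dir_def sum_distrib_right)
qed

lemma scal_G: "scal G x = (\<Sum>i\<in>UNIV. ric_dir i (x $ 1))"
proof -
  have "scal G x = (\<Sum>i\<in>UNIV. exp (- 2 * f i (x $ 1)) * ric G i i x)"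
    unfolding scal_def ginv_G by (simp add: if_distrib[of "\<lambda>z. z * _"] cong: if_cong)
  also have "\<dots> = (\<Sum>i\<in>UNIV. ric_dir i (x $ 1))"
    by (rule sum.cong) (simp_all add: ric_G exp_minus)
  finally show ?thesis .
qed

context
  assumes f_0: "\<And>i. f i 0 = 0"
begin

lemma G_0: "G 0 $ i $ j = (if i = j then 1 else 0)" "ginv G i j 0 = (if i = j then 1 else 0)"
  by (simp_all add: G_nth ginv_G f_0)

lemma riem_0: "riem G i j k l 0 =
    sectional i j 0 * ((if i = l \<and> j = k then 1 else 0) - (if i = k \<and> j = l then 1 else 0))"
  by (simp add: riem_G f_0)

lemma ric_0: "ric G i j 0 = (if i = j then ric_dir i 0 else 0)"
  by (simp add: ric_G f_0)

text \<open>The coordinate frame is orthonormal at the origin. The factors 2 at \<open>c1\<close>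
  and \<open>c4\<close> count the two orders of an index pair spanning the same plane; the one at
  \<open>c6\<close> is part of \<open>L_ric\<close>.\<close>

lemma curvature_combination_0:
  "curvature_combination c1 c2 c3 c4 c5 c6 c7 c8 c9 c10 G i i 0 =
     2 * c1 * (\<Sum>a\<in>UNIV. \<Sum>b\<in>UNIV. (sectional a b 0)\<^sup>2) + c2 * (\<Sum>a\<in>UNIV. (ric_dir a 0)\<^sup>2)
     + c3 * (\<Sum>a\<in>UNIV. ric_dir a 0)\<^sup>2 + 2 * c4 * (\<Sum>a\<in>UNIV. (sectional a i 0)\<^sup>2)
     + c5 * (ric_dir i 0)\<^sup>2 + 2 * c6 * (\<Sum>a\<in>UNIV. sectional a i 0 * ric_dir a 0)
     + c7 * (\<Sum>a\<in>UNIV. ric_dir a 0) * ric_dir i 0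
     + c8 * lap_scal G 0 + c9 * hess_scal G i i 0 + c10 * rough_lap_ric G i i 0"
proof -
  have "riem_norm2 G 0 = 2 * (\<Sum>a\<in>UNIV. \<Sum>b\<in>UNIV. (sectional a b 0)\<^sup>2)"
  proof -
    have "(riem G a b c d 0)\<^sup>2 = (if a = d then if b = c then (sectional a b 0)\<^sup>2 else 0 else 0)
        + (if b = d then if a = c then (sectional a b 0)\<^sup>2 else 0 else 0)" for a b c d
      unfolding riem_0 by auto
    then show ?thesis
      unfolding orthonormal_contractions(1)[OF G_0(2)]
      by (simp add: sum.distrib sum_distrib_left cong: if_cong)
  qed
  moreover have "ric_norm2 G 0 = (\<Sum>a\<in>UNIV. (ric_dir a 0)\<^sup>2)"
    unfolding orthonormal_contractions(2)[OF G_0(2)] ric_0 sum_4 by simp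
  moreover have "riem_check G i i 0 = 2 * (\<Sum>a\<in>UNIV. (sectional a i 0)\<^sup>2)"
    unfolding orthonormal_contractions(3)[OF G_0(2)] riem_0
    using exhaust_4[of i] unfolding sum_4
    by (elim disjE; hypsubst; simp add: power2_eq_square sectional_sym)
  moreover have "ric_check G i i 0 = (ric_dir i 0)\<^sup>2"
    unfolding orthonormal_contractions(4)[OF G_0(2)] ric_0
    using exhaust_4[of i] unfolding sum_4
    by (elim disjE; hypsubst; simp add: power2_eq_square)
  moreover have "L_ric G i i 0 = 2 * (\<Sum>a\<in>UNIV. sectional a i 0 * ric_dir a 0)"
    unfolding orthonormal_contractions(5)[OF G_0(2)] ric_0 riem_0
    using exhaust_4[of i] unfolding sum_4
    by (elim disjE; hypsubst; simp add: sectional_sym)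
  moreover have "scal G 0 = (\<Sum>a\<in>UNIV. ric_dir a 0)"
    by (simp add: scal_G)
  ultimately show ?thesis
    unfolding curvature_combination_def by (simp add: G_0 ric_0 mult_ac)
qed

context
  fixes r' :: "4 \<Rightarrow> real \<Rightarrow> real" and r'' :: "4 \<Rightarrow> real"
  assumes r': "\<And>i t. (ric_dir i has_real_derivative r' i t) (at t)"
    and r'': "\<And>i. (r' i has_real_derivative r'' i) (at 0)"
    and f'_0: "\<And>i. f' i 0 = 0"
begin

lemma christoffel_0: "christoffel G k i j 0 = 0"
  by (simp add: christoffel_G f'_0)

lemma hess_scal_0: "hess_scal G i j 0 = (if i = 1 \<and> j = 1 then \<Sum>a\<in>UNIV. r'' a else 0)"
proof -
  have "pd j (scal G) x = (if j = 1 then \<Sum>a\<in>UNIV. r' a (x $ 1) else 0)" for x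
    unfolding scal_G[abs_def]
    by (rule pd_coordinate) (rule DERIV_sum, rule r')
  then have "pd j (scal G) = (\<lambda>x. if j = 1 then \<Sum>a\<in>UNIV. r' a (x $ 1) else 0)" by blast
  moreover have "pd i (\<lambda>x::real^4. \<Sum>a\<in>UNIV. r' a (x $ 1)) 0 = (if i = 1 then \<Sum>a\<in>UNIV. r'' a else 0)"
    by (rule pd_coordinate) (rule DERIV_sum, simp add: r'')
  ultimately show ?thesis
    by (cases "i = 1"; cases "j = 1") (simp_all add: hess_scal_def cov1_def christoffel_0)
qed

text \<open>Required at every point, since the rough Laplacian differentiates it once more. The
  rescaled fields exp (- f i) times the i-th coordinate field are parallel along the x1-lines, so
  the Christoffel terms cancel the derivative of the exponential factor.\<close>

lemma cov2_ric_G: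
  "cov2 G (ric G) a i i x = (if a = 1 then r' i (x $ 1) * exp (2 * f i (x $ 1)) else 0)"
proof -
  have "((\<lambda>t. ric_dir i t * exp (2 * f i t)) has_real_derivative
      (r' i t + 2 * f' i t * ric_dir i t) * exp (2 * f i t)) (at t)" for t
    by (rule derivative_eq_intros r' f_deriv refl | simp add: algebra_simps)+
  from pd_coordinate[OF this[of "x $ 1"], of a]
  have pd: "pd a (ric G i i) x = (if a = 1 then
      (r' i (x $ 1) + 2 * f' i (x $ 1) * ric_dir i (x $ 1)) * exp (2 * f i (x $ 1)) else 0)"
    by (simp add: ric_G[abs_def])
  have "christoffel G i a i x = (if a = 1 then f' i (x $ 1) else 0)"
    by (simp add: christoffel_G f_1)
  then show ?thesis
    unfolding cov2_def pd by (simp add: ric_G if_distrib[of "\<lambda>z. _ * z"] algebra_simps cong: if_cong)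
qed

lemma rough_lap_ric_0: "rough_lap_ric G i i 0 = r'' i"
proof -
  have "((\<lambda>t. r' i t * exp (2 * f i t)) has_real_derivative r'' i) (at ((0::real^4) $ 1))"
    by (rule derivative_eq_intros r'' f_deriv refl | simp add: f_0 f'_0 r'')+
  note d = pd_coordinate[OF this]
  have "cov2 G (ric G) a i i = (\<lambda>x. if a = 1 then r' i (x $ 1) * exp (2 * f i (x $ 1)) else 0)" for a
    by (rule ext) (rule cov2_ric_G)
  then have "pd a (cov2 G (ric G) a i i) 0 = (if a = 1 then r'' i else 0)" for a
    using d[of a] by (cases "a = 1") simp_all
  then have "cov3 G (cov2 G (ric G)) a a i i 0 = (if a = 1 then r'' i else 0)" for a
    by (simp add: cov3_def christoffel_0)
  then show ?thesis
    unfolding orthonormal_contractions(7)[OF G_0(2)] by simp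
qed

lemma lap_scal_0: "lap_scal G 0 = (\<Sum>a\<in>UNIV. r'' a)"
  unfolding orthonormal_contractions(6)[OF G_0(2)] by (simp add: hess_scal_0)

end

end

lemma smooth_on_G:
  assumes "\<And>i. f i \<in> elementary"
  shows "smooth_on S (\<lambda>x. G x $ i $ j)"
proof -
  have "(\<lambda>t. exp (2 * f i t)) \<in> elementary"
    by (intro elementary.intros assms)
  from smooth_on_elementary[OF this, where S = S and a = 1] show ?thesis
    using smooth_on_elementary[OF elementary.const[of 0], where S = S] by (cases "i = j") (auto simp: G_nth)
qed

end

section \<open>Determination of the coefficients\<close>

text \<open>Taylor polynomials with first, second and fourth derivatives \<alpha>, \<beta>, \<delta>
  at 0. The missing constant term makes the frame orthonormal at the origin.\<close>

definition quartic :: "(4 \<Rightarrow> real) \<Rightarrow> (4 \<Rightarrow> real) \<Rightarrow> (4 \<Rightarrow> real) \<Rightarrow> 4 \<Rightarrow> real \<Rightarrow> real" where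
  "quartic \<alpha> \<beta> \<delta> i t = \<alpha> i * t + \<beta> i / 2 * t ^ 2 + \<delta> i / 24 * t ^ 4"

definition quartic' :: "(4 \<Rightarrow> real) \<Rightarrow> (4 \<Rightarrow> real) \<Rightarrow> (4 \<Rightarrow> real) \<Rightarrow> 4 \<Rightarrow> real \<Rightarrow> real" where
  "quartic' \<alpha> \<beta> \<delta> i t = \<alpha> i + \<beta> i * t + \<delta> i / 6 * t ^ 3"

definition quartic'' :: "(4 \<Rightarrow> real) \<Rightarrow> (4 \<Rightarrow> real) \<Rightarrow> (4 \<Rightarrow> real) \<Rightarrow> 4 \<Rightarrow> real \<Rightarrow> real" where
  "quartic'' \<alpha> \<beta> \<delta> i t = \<beta> i + \<delta> i / 2 * t ^ 2"

lemma quartic_elementary: "quartic \<alpha> \<beta> \<delta> i \<in> elementary"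
  unfolding quartic_def[abs_def] power4_eq_xxxx power2_eq_square
  by (intro elementary.add elementary.mult elementary.const elementary.ident)

lemma warped_metric_quartic:
  assumes "\<alpha> 1 = 0" "\<beta> 1 = 0" "\<delta> 1 = 0"
  shows "warped_metric (quartic \<alpha> \<beta> \<delta>) (quartic' \<alpha> \<beta> \<delta>) (quartic'' \<alpha> \<beta> \<delta>)"
proof
  show "quartic \<alpha> \<beta> \<delta> 1 = (\<lambda>t. 0)" "quartic' \<alpha> \<beta> \<delta> 1 = (\<lambda>t. 0)" "quartic'' \<alpha> \<beta> \<delta> 1 = (\<lambda>t. 0)"
    using assms by (simp_all add: fun_eq_iff quartic_def quartic'_def quartic''_def)
  fix i t
  show "(quartic \<alpha> \<beta> \<delta> i has_real_derivative quartic' \<alpha> \<beta> \<delta> i t) (at t)"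
    unfolding quartic_def[abs_def] quartic'_def
    by (rule derivative_eq_intros refl | simp)+
  show "(quartic' \<alpha> \<beta> \<delta> i has_real_derivative quartic'' \<alpha> \<beta> \<delta> i t) (at t)"
    unfolding quartic'_def[abs_def] quartic''_def
    by (rule derivative_eq_intros refl | simp)+
qed

lemma coefficients_determined:
  assumes comb: "\<And>\<alpha> \<beta> \<delta> i. \<alpha> 1 = 0 \<Longrightarrow> \<beta> 1 = 0 \<Longrightarrow> \<delta> 1 = 0 \<Longrightarrow>
    curvature_combination c1 c2 c3 c4 c5 c6 c7 c8 c9 c10
      (warped_metric.G (quartic \<alpha> \<beta> \<delta>)) i i 0 = 0"
  shows "\<exists>r::real. c1 = r / 4 \<and> c2 = - r \<and> c3 = r / 4 \<and> c4 = - r \<and> c5 = 2 * r \<and>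
        c6 = r \<and> c7 = - r \<and> c8 = 0 \<and> c9 = 0 \<and> c10 = 0"
proof -
  have q0: "quartic \<alpha> \<beta> \<delta> i 0 = 0" for \<alpha> \<beta> \<delta> i by (simp add: quartic_def)
  have derivative_coefficients: "c8 = 0 \<and> c9 = 0 \<and> c10 = 0"
  proof -
    define \<delta> :: "4 \<Rightarrow> real" where "\<delta> i = (if i = 2 then 1 else 0)" for i
    let ?z = "\<lambda>i::4. 0 :: real"
    interpret warped_metric "quartic ?z ?z \<delta>" "quartic' ?z ?z \<delta>" "quartic'' ?z ?z \<delta>"
      by (rule warped_metric_quartic) (simp_all add: \<delta>_def)
    \<comment> \<open>Only the plane of the first two directions is curved, with curvature - (t^2 /
      2 + t^6 / 36), which is also the Ricci curvature in both directions.\<close>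
    define r' :: "4 \<Rightarrow> real \<Rightarrow> real" where
      "r' i t = (if i = 1 \<or> i = 2 then - (t + t ^ 5 / 6) else 0)" for i t
    define r'' :: "4 \<Rightarrow> real" where "r'' i = (if i = 1 \<or> i = 2 then - 1 else 0)" for i
    have ric_dir: "ric_dir i = (\<lambda>t. if i = 1 \<or> i = 2 then - (t ^ 2 / 2 + t ^ 6 / 36) else 0)" for i
      using exhaust_4[of i]
      by (elim disjE; simp add: ric_dir_def sectional_def sum_4 quartic'_def quartic''_def \<delta>_def fun_eq_iff
          power_divide flip: power_mult)
    have r': "(ric_dir i has_real_derivative r' i t) (at t)" for i t
    proof -
      have "((\<lambda>t::real. - (t ^ 2 / 2 + t ^ 6 / 36)) has_real_derivative - (t + t ^ 5 / 6)) (at t)"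
        by (rule derivative_eq_intros refl | simp)+
      then show ?thesis by (simp add: ric_dir r'_def)
    qed
    have r'': "(r' i has_real_derivative r'' i) (at 0)" for i
    proof -
      have "((\<lambda>t::real. - (t + t ^ 5 / 6)) has_real_derivative - 1) (at 0)"
        by (rule derivative_eq_intros refl | simp)+
      then show ?thesis by (simp add: r'_def[abs_def] r''_def)
    qed
    have f'_0: "quartic' ?z ?z \<delta> i 0 = 0" for i by (simp add: quartic'_def)
    note terms = curvature_combination_0[OF q0] lap_scal_0[OF q0 r' r'' f'_0]
      hess_scal_0[OF q0 r' r'' f'_0] rough_lap_ric_0[OF q0 r' r'' f'_0]
    have sectional_0: "sectional a b 0 = 0" for a b
      by (simp add: sectional_def quartic'_def quartic''_def)
    then have "ric_dir a 0 = 0" for a by (simp add: ric_dir_def)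
    with sectional_0 have "c8 * (\<Sum>a\<in>UNIV. r'' a) + c9 * (if i = 1 then \<Sum>a\<in>UNIV. r'' a else 0) + c10 * r'' i = 0" for i
      using comb[of ?z ?z \<delta> i] by (simp add: terms \<delta>_def)
    \<comment> \<open>The sum of \<open>r''\<close> is -2. Direction 3 sees only \<open>c8\<close>,
      direction 2 also \<open>c10\<close>, and direction 1 all three coefficients.\<close>
    from this[of 1] this[of 2] this[of 3] show ?thesis
      by (simp add: r''_def sum_4)
  qed
  have quadratic: "2 * c1 * (\<Sum>a\<in>UNIV. \<Sum>b\<in>UNIV. (s a b)\<^sup>2) + c2 * (\<Sum>a\<in>UNIV. (r a)\<^sup>2)
      + c3 * (\<Sum>a\<in>UNIV. r a)\<^sup>2 + 2 * c4 * (\<Sum>a\<in>UNIV. (s a i)\<^sup>2) + c5 * (r i)\<^sup>2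
      + 2 * c6 * (\<Sum>a\<in>UNIV. s a i * r a) + c7 * (\<Sum>a\<in>UNIV. r a) * r i = 0"
    if "\<alpha> 1 = 0" "\<beta> 1 = 0"
      and s: "\<And>i j. s i j = (if i = j then 0 else if i = 1 then - (\<beta> j + (\<alpha> j)\<^sup>2)
        else if j = 1 then - (\<beta> i + (\<alpha> i)\<^sup>2) else - (\<alpha> i * \<alpha> j))"
      and r: "\<And>i. r i = (\<Sum>a\<in>UNIV. s a i)"
    for \<alpha> \<beta> :: "4 \<Rightarrow> real" and s r i
  proof -
    let ?z = "\<lambda>i::4. 0 :: real"
    interpret warped_metric "quartic \<alpha> \<beta> ?z" "quartic' \<alpha> \<beta> ?z" "quartic'' \<alpha> \<beta> ?z"
      by (rule warped_metric_quartic) (simp_all add: that)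
    have sectional: "sectional i j 0 = s i j" for i j
      unfolding s sectional_def by (simp add: quartic'_def quartic''_def)
    then have "ric_dir i 0 = r i" for i by (simp add: ric_dir_def r)
    with sectional show ?thesis
      using comb[of \<alpha> \<beta> ?z i] that(1,2) derivative_coefficients
      by (simp add: curvature_combination_0[OF q0])
  qed
  note q = quadratic[OF _ _ refl refl, unfolded sum_4]
  \<comment> \<open>The product of a surface with a flat plane, of curvature -1 at the origin: one
    equation along each factor.\<close>
  have 1: "4 * c1 + 2 * c2 + 4 * c3 + 2 * c4 + c5 + 2 * c6 + 2 * c7 = 0"
    using q[of "\<lambda>i. 0" "\<lambda>i. if i = 2 then 1 else 0" 1] by simp
  have 2: "4 * c1 + 2 * c2 + 4 * c3 = 0"
    using q[of "\<lambda>i. 0" "\<lambda>i. if i = 2 then 1 else 0" 3] by simp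
  \<comment> \<open>A three-dimensional metric times a line, with K_12 = K_13 = -1 at the origin and
    all other coordinate planes flat there.\<close>
  have 3: "8 * c1 + 6 * c2 + 16 * c3 + 4 * c4 + 4 * c5 + 4 * c6 + 8 * c7 = 0"
    using q[of "\<lambda>i. 0" "\<lambda>i. if i = 2 \<or> i = 3 then 1 else 0" 1] by simp
  have 4: "8 * c1 + 6 * c2 + 16 * c3 + 2 * c4 + c5 + 4 * c6 + 4 * c7 = 0"
    using q[of "\<lambda>i. 0" "\<lambda>i. if i = 2 \<or> i = 3 then 1 else 0" 2] by simp
  have 5: "8 * c1 + 6 * c2 + 16 * c3 = 0"
    using q[of "\<lambda>i. 0" "\<lambda>i. if i = 2 \<or> i = 3 then 1 else 0" 4] by simp
  \<comment> \<open>For \<open>\<alpha> = 0\<close> the planes not containing the first direction are flat at the origin, which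
    leaves two free parameters.\<close>
  have 6: "8 * c1 + 4 * c2 + 2 * c4 + c5 + 2 * c6 = 0"
    using q[of "\<lambda>i. if i = 2 \<or> i = 3 then 1 else 0" "\<lambda>i. if i = 1 then 0 else - 1" 1] by simp
  show ?thesis
    by (rule exI[of _ "4 * c3"], intro conjI)
      (use 1 2 3 4 5 6 derivative_coefficients in linarith)+
qed

theorem theorem1p1:
  fixes emb :: "real^4 \<Rightarrow> 'p"
    and c1 c2 c3 c4 c5 c6 c7 c8 c9 c10 :: real
  assumes "inj emb"
  shows
    "(\<forall>(X :: 'p topology) (A :: ('p, 4) chart set) g.
        riemannian_manifold X A g \<longrightarrow>
        (\<forall>p\<in>topspace X. \<forall>(U, \<phi>)\<in>A. p \<in> U \<longrightarrow>
          (let G = g (U, \<phi>); x = \<phi> p in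
           \<forall>i j.
             c1 * riem_norm2 G x * G x $ i $ j + c2 * ric_norm2 G x * G x $ i $ j
             + c3 * (scal G x)\<^sup>2 * G x $ i $ j + c4 * riem_check G i j x
             + c5 * ric_check G i j x + c6 * L_ric G i j x + c7 * scal G x * ric G i j x
             + c8 * lap_scal G x * G x $ i $ j + c9 * hess_scal G i j x
             + c10 * rough_lap_ric G i j x = 0)))
     \<longleftrightarrow>
     (\<exists>r::real. c1 = r / 4 \<and> c2 = - r \<and> c3 = r / 4 \<and> c4 = - r \<and> c5 = 2 * r \<and>
        c6 = r \<and> c7 = - r \<and> c8 = 0 \<and> c9 = 0 \<and> c10 = 0)"
  (is "?identity \<longleftrightarrow> ?coefficients")
proof
  assume id: ?identity
  show ?coefficients
  proof (rule coefficients_determined)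
    fix \<alpha> \<beta> \<delta> :: "4 \<Rightarrow> real" and i :: 4
    assume "\<alpha> 1 = 0" "\<beta> 1 = 0" "\<delta> 1 = 0"
    then interpret warped_metric "quartic \<alpha> \<beta> \<delta>" "quartic' \<alpha> \<beta> \<delta>" "quartic'' \<alpha> \<beta> \<delta>"
      by (rule warped_metric_quartic)
    let ?X = "pullback_topology (range emb) (inv emb) euclidean"
    let ?A = "{(range emb, inv emb)} :: ('p, 4) chart set"
    note manifold = global_chart_manifold[OF \<open>inj emb\<close> smooth_on_G[OF quartic_elementary]
      transpose_G G_pos]
    have "emb 0 \<in> topspace ?X" using manifold(1) by simp
    from id[rule_format, OF manifold(2) this, of "(range emb, inv emb)"]
    show "curvature_combination c1 c2 c3 c4 c5 c6 c7 c8 c9 c10 G i i 0 = 0"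
      using \<open>inj emb\<close> by (simp add: curvature_combination_def Let_def)
  qed
next
  assume ?coefficients
  then obtain r where r: "c1 = r / 4" "c2 = - r" "c3 = r / 4" "c4 = - r" "c5 = 2 * r"
    "c6 = r" "c7 = - r" "c8 = 0" "c9 = 0" "c10 = 0" by blast
  show ?identity
  proof (intro allI impI ballI, clarify)
    fix X :: "'p topology" and A :: "('p, 4) chart set" and g p U \<phi>
    assume *: "riemannian_manifold X A g" "(U, \<phi>) \<in> A" "p \<in> U"
    then have "\<phi> p \<in> snd (U, \<phi>) ` fst (U, \<phi>)" by simp
    note eq = curvature_identity_coordinates[OF riemannian_metric_coordinates[OF *(1,2)] this]
    show "let G = g (U, \<phi>); x = \<phi> p in
           \<forall>i j.
             c1 * riem_norm2 G x * G x $ i $ j + c2 * ric_norm2 G x * G x $ i $ j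
             + c3 * (scal G x)\<^sup>2 * G x $ i $ j + c4 * riem_check G i j x
             + c5 * ric_check G i j x + c6 * L_ric G i j x + c7 * scal G x * ric G i j x
             + c8 * lap_scal G x * G x $ i $ j + c9 * hess_scal G i j x
             + c10 * rough_lap_ric G i j x = 0"
      unfolding Let_def r
    proof (intro allI)
      fix i j
      show "r / 4 * riem_norm2 (g (U, \<phi>)) (\<phi> p) * g (U, \<phi>) (\<phi> p) $ i $ j
          + - r * ric_norm2 (g (U, \<phi>)) (\<phi> p) * g (U, \<phi>) (\<phi> p) $ i $ j
          + r / 4 * (scal (g (U, \<phi>)) (\<phi> p))\<^sup>2 * g (U, \<phi>) (\<phi> p) $ i $ j
          + - r * riem_check (g (U, \<phi>)) i j (\<phi> p) + 2 * r * ric_check (g (U, \<phi>)) i j (\<phi> p)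
          + r * L_ric (g (U, \<phi>)) i j (\<phi> p)
          + - r * scal (g (U, \<phi>)) (\<phi> p) * ric (g (U, \<phi>)) i j (\<phi> p)
          + 0 * lap_scal (g (U, \<phi>)) (\<phi> p) * g (U, \<phi>) (\<phi> p) $ i $ j
          + 0 * hess_scal (g (U, \<phi>)) i j (\<phi> p) + 0 * rough_lap_ric (g (U, \<phi>)) i j (\<phi> p) = 0"
        using arg_cong[OF eq[of i j], of "\<lambda>z. r * z"] by (simp add: algebra_simps)
    qed
  qed
qed

end
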